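(* Suppose that, under the probability law $\mathbb P$ (with expectation $\mathbb E$), the sequence of real-valued observations $(X_j)_{j\ge1}$ is exchangeable and the randomizers $(\lambda_j)_{j\ge1}$ are iid uniform on $(0,1)$ and independent of $(X_j)_{j\ge 1}$. Let $w=(w_k)_{k\ge1}$ be a deterministic sequence with $w_k\in[0,\infty)$ and let $b>0$. Write $\|w\|_1:=\sum_{k\ge1}w_k$, $\|w\|_\infty:=\sup_{k\ge1}w_k$, $W_t:=\sum_{k=1}^t w_k$, $W_\infty:=\|w\|_1$. Let $S^{(w)}_t,Z^{(w)}_t,\tau_{S,w}(b),\tau_{Z,w}(b)$ be the weighted restarted statistics and alarms defined in the context; all stopping times are with respect to $(\mathcal G_t)_{t\ge0}$. Then: 1. If $\|w\|_1<\infty$, the process $\widetilde S^{(w)}_t:=S^{(w)}_t+\sum_{k>t}w_k$, $t\ge0$, is a nonnegative martingale with initial value $\widetilde S^{(w)}_0=\|w\|_1$. Consequently $$\mathbb P\{\tau_{S,w}(b)<\infty\}\le\frac{\|w\|_1}{b},\qquad \mathbb P\{\tau_{Z,w}(b)<\infty\}\le\frac{\|w\|_1}{b}.$$ 2. For every weight sequence $w$ and every stopping time $\tau$ with $\mathbb E\tau<\infty$, $$\mathbb E S^{(w)}_\tau\le\mathbb E W_\tau,\qquad \mathbb E Z^{(w)}_\tau\le\mathbb E W_\tau,$$ where $\mathbb E W_\tau$ is allowed to be infinite. Consequently, for any stopping time $\sigma$, $$\mathbb P\{\tau_{S,w}(b)<\infty,\ \tau_{S,w}(b)\le\sigma\}\le\frac{\mathbb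 E W_{\tau_{S,w}(b)\wedge\sigma}}{b},\qquad \mathbb P\{\tau_{Z,w}(b)<\infty,\ \tau_{Z,w}(b)\le\sigma\}\le\frac{\mathbb E W_{\tau_{Z,w}(b)\wedge\sigma}}{b}.$$ If, in addition, $0<\|w\|_\infty<\infty$, then $\mathbb E W_\tau\le\|w\|_\infty\mathbb E\tau$, so $S^{(w)}/\|w\|_\infty$ and $Z^{(w)}/\|w\|_\infty$ are e-detectors, and $$\mathbb E\,\tau_{S,w}(b)\ge\frac{b}{\|w\|_\infty},\qquad \mathbb E\,\tau_{Z,w}(b)\ge\frac{b}{\|w\|_\infty}.$$ In this case, moreover, for every stopping time $\sigma$, $$\max\big(\mathbb P\{\tau_{S,w}(b)<\infty,\ \tau_{S,w}(b)\le\sigma\},\ \mathbb P\{\tau_{Z,w}(b)<\infty,\ \tau_{Z,w}(b)\le\sigma\}\big)\le\frac{\|w\|_\infty\,\mathbb E[\sigma]}{b}.$$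
   Context: Conformal p-values: $p_t:=\frac1t\big(\sum_{i=1}^t\mathbf 1\{X_i<X_t\}+\lambda_t\sum_{i=1}^t\mathbf 1\{X_i=X_t\}\big)$, $t\ge1$. Filtration: $\mathcal G_0$ trivial, $\mathcal G_t:=\sigma(p_1,\dots,p_t)$. Stopping times take values in $\{0,1,2,\dots\}\cup\{\infty\}$. Betting class: $\{f_\theta:\theta\in\Theta\}$ is a family of probability densities on $[0,1]$ with $(\theta,u)\mapsto f_\theta(u)$ jointly measurable, and $\Pi$ is a probability measure on $\Theta$. For $1\le k\le t$, $M_{k,t}:=\int_\Theta\prod_{j=k}^t f_\theta(p_j)\,d\Pi(\theta)$. For $t\ge1$: $S^{(w)}_t:=\sum_{k=1}^t w_kM_{k,t}$, $Z^{(w)}_t:=\max_{1\le k\le t}w_kM_{k,t}$, and $S^{(w)}_0=Z^{(w)}_0=W_0:=0$. Alarms: $\tau_{S,w}(b):=\inf\{t\ge1:S^{(w)}_t\ge b\}$, $\tau_{Z,w}(b):=\inf\{t\ge1:Z^{(w)}_t\ge b\}$, with $\inf\varnothing:=\infty$. A nonnegative adapted process $D$ is an e-detector if $\mathbb E D_\tau\le\mathbb E\tau$ for every stopping time $\tau$, where $D_\tau:=\liminf_{m\to\infty}D_{\tau\wedge m}$ on $\{\tau=\infty\}$. *)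

theory Defs
  imports "HOL-Probability.Probability"
begin

text \<open>
  All sequences are indexed by the positive naturals; their value at index \<open>0\<close> is irrelevant.
  Nonnegative quantities that may be infinite (the statistics, sums of weights, expectations)
  live in \<^typ>\<open>ennreal\<close>, and random times in \<^typ>\<open>enat\<close>.
\<close>

section \<open>Data\<close>

text \<open>An infinite sequence is exchangeable if every finite initial segment has a
  permutation-invariant joint law.\<close>

definition exchangeable :: "'a measure \<Rightarrow> (nat \<Rightarrow> 'a \<Rightarrow> real) \<Rightarrow> bool" where
  "exchangeable M X \<longleftrightarrow>
     (\<forall>j\<ge>1. X j \<in> borel_measurable M) \<and>
     (\<forall>n \<pi>. \<pi> permutes {1..n} \<longrightarrow>
        distr M (PiM {1..n} (\<lambda>_. borel)) (\<lambda>\<omega>. \<lambda>i\<in>{1..n}. X (\<pi> i) \<omega>) =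
        distr M (PiM {1..n} (\<lambda>_. borel)) (\<lambda>\<omega>. \<lambda>i\<in>{1..n}. X i \<omega>))"

definition iid_uniform :: "'a measure \<Rightarrow> (nat \<Rightarrow> 'a \<Rightarrow> real) \<Rightarrow> bool" where
  "iid_uniform M lam \<longleftrightarrow>
     prob_space.indep_vars M (\<lambda>_. borel) lam {1..} \<and>
     (\<forall>j\<ge>1. distr M borel (lam j) = uniform_measure lborel {0<..<1})"

definition indep_sequences ::
    "'a measure \<Rightarrow> (nat \<Rightarrow> 'a \<Rightarrow> real) \<Rightarrow> (nat \<Rightarrow> 'a \<Rightarrow> real) \<Rightarrow> bool" where
  "indep_sequences M X Y \<longleftrightarrow>
     prob_space.indep_var M
       (PiM {1..} (\<lambda>_. borel)) (\<lambda>\<omega>. \<lambda>j\<in>{1..}. X j \<omega>)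
       (PiM {1..} (\<lambda>_. borel)) (\<lambda>\<omega>. \<lambda>j\<in>{1..}. Y j \<omega>)"

definition conformal_p ::
    "(nat \<Rightarrow> 'a \<Rightarrow> real) \<Rightarrow> (nat \<Rightarrow> 'a \<Rightarrow> real) \<Rightarrow> nat \<Rightarrow> 'a \<Rightarrow> real" where
  "conformal_p X lam t \<omega> =
     ((\<Sum>i=1..t. of_bool (X i \<omega> < X t \<omega>))
        + lam t \<omega> * (\<Sum>i=1..t. of_bool (X i \<omega> = X t \<omega>))) / real t"

text \<open>The index set of the filtration is \<^typ>\<open>enat\<close>, so that the library's
  \<^const>\<open>stopping_time\<close> covers stopping times with values in the naturals and infinity: at
  \<open>t = \<infinity>\<close> its measurability requirement is vacuous, whatever \<open>p_filtration M p \<infinity>\<close> is.\<close>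

definition p_filtration :: "'a measure \<Rightarrow> (nat \<Rightarrow> 'a \<Rightarrow> real) \<Rightarrow> enat \<Rightarrow> 'a measure" where
  "p_filtration M p t =
     sigma (space M) {p i -` A \<inter> space M | i A. 1 \<le> i \<and> enat i \<le> t \<and> A \<in> sets borel}"

section \<open>Processes\<close>

text \<open>Martingales with values in the extended nonnegative reals. Finiteness of the expectations
  makes every \<open>D t\<close> almost surely finite and integrable.\<close>

definition nonneg_martingale ::
    "'a measure \<Rightarrow> (enat \<Rightarrow> 'a measure) \<Rightarrow> (nat \<Rightarrow> 'a \<Rightarrow> ennreal) \<Rightarrow> bool" where
  "nonneg_martingale M F D \<longleftrightarrow>
     filtration (space M) F \<and>
     (\<forall>t::nat. subalgebra M (F t)) \<and>
     (\<forall>t::nat. D t \<in> borel_measurable (F t)) \<and>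
     (\<forall>t. (\<integral>\<^sup>+\<omega>. D t \<omega> \<partial>M) < \<infinity>) \<and>
     (\<forall>s t::nat. s \<le> t \<longrightarrow> (AE \<omega> in M. nn_cond_exp M (F s) (D t) \<omega> = D s \<omega>))"

definition stopped :: "(nat \<Rightarrow> 'a \<Rightarrow> ennreal) \<Rightarrow> ('a \<Rightarrow> enat) \<Rightarrow> 'a \<Rightarrow> ennreal" where
  "stopped D T \<omega> = (case T \<omega> of enat n \<Rightarrow> D n \<omega> | \<infinity> \<Rightarrow> liminf (\<lambda>m. D m \<omega>))"

definition e_detector ::
    "'a measure \<Rightarrow> (enat \<Rightarrow> 'a measure) \<Rightarrow> (nat \<Rightarrow> 'a \<Rightarrow> ennreal) \<Rightarrow> bool" where
  "e_detector M F D \<longleftrightarrow>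
     (\<forall>t::nat. D t \<in> borel_measurable (F t)) \<and>
     (\<forall>T. stopping_time F T \<longrightarrow>
        (\<integral>\<^sup>+\<omega>. stopped D T \<omega> \<partial>M) \<le> (\<integral>\<^sup>+\<omega>. ennreal_of_enat (T \<omega>) \<partial>M))"

section \<open>Restarted mixture statistics\<close>

text \<open>The parameter set is \<^term>\<open>space Q\<close>, with mixing distribution \<^term>\<open>Q\<close>. Densities on
  \<open>[0,1]\<close> are given by some jointly measurable extension to the real line, for instance
  by \<open>0\<close>; nothing else is assumed about the extension, which only matters on the null event
  that some \<open>p\<close>-value falls outside \<open>[0,1]\<close>.\<close>

definition betting_class :: "'th measure \<Rightarrow> ('th \<Rightarrow> real \<Rightarrow> real) \<Rightarrow> bool" where
  "betting_class Q f \<longleftrightarrow>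
     prob_space Q \<and>
     (\<lambda>(\<theta>, u). f \<theta> u) \<in> borel_measurable (Q \<Otimes>\<^sub>M borel) \<and>
     (\<forall>\<theta>\<in>space Q. (\<forall>u\<in>{0..1}. 0 \<le> f \<theta> u) \<and>
        (\<integral>\<^sup>+u\<in>{0..1}. ennreal (f \<theta> u) \<partial>lborel) = 1)"

definition restarted ::
    "'th measure \<Rightarrow> ('th \<Rightarrow> real \<Rightarrow> real) \<Rightarrow> (nat \<Rightarrow> 'a \<Rightarrow> real) \<Rightarrow> nat \<Rightarrow> nat \<Rightarrow> 'a \<Rightarrow> ennreal" where
  "restarted Q f p k t \<omega> = (\<integral>\<^sup>+\<theta>. (\<Prod>j=k..t. ennreal (f \<theta> (p j \<omega>))) \<partial>Q)"

definition S_stat ::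
    "'th measure \<Rightarrow> ('th \<Rightarrow> real \<Rightarrow> real) \<Rightarrow> (nat \<Rightarrow> 'a \<Rightarrow> real) \<Rightarrow> (nat \<Rightarrow> real) \<Rightarrow> nat \<Rightarrow> 'a \<Rightarrow> ennreal" where
  "S_stat Q f p w t \<omega> = (\<Sum>k=1..t. ennreal (w k) * restarted Q f p k t \<omega>)"

definition Z_stat ::
    "'th measure \<Rightarrow> ('th \<Rightarrow> real \<Rightarrow> real) \<Rightarrow> (nat \<Rightarrow> 'a \<Rightarrow> real) \<Rightarrow> (nat \<Rightarrow> real) \<Rightarrow> nat \<Rightarrow> 'a \<Rightarrow> ennreal" where
  "Z_stat Q f p w t \<omega> =
     (if t = 0 then 0 else Max ((\<lambda>k. ennreal (w k) * restarted Q f p k t \<omega>) ` {1..t}))"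

text \<open>\<^term>\<open>Inf {} = (\<infinity> :: enat)\<close>.\<close>

definition alarm :: "(nat \<Rightarrow> 'a \<Rightarrow> ennreal) \<Rightarrow> real \<Rightarrow> 'a \<Rightarrow> enat" where
  "alarm D b \<omega> = Inf {enat t | t. 1 \<le> t \<and> ennreal b \<le> D t \<omega>}"

section \<open>Weights\<close>

definition weight_tail :: "(nat \<Rightarrow> real) \<Rightarrow> nat \<Rightarrow> ennreal" where
  "weight_tail w t = (\<Sum>i. ennreal (w (t + 1 + i)))"

definition norm_1 :: "(nat \<Rightarrow> real) \<Rightarrow> ennreal" where
  "norm_1 w = (\<Sum>i. ennreal (w (i + 1)))"

definition norm_inf :: "(nat \<Rightarrow> real) \<Rightarrow> ennreal" where
  "norm_inf w = (SUP k\<in>{1..}. ennreal (w k))"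

definition cum_weight :: "(nat \<Rightarrow> real) \<Rightarrow> enat \<Rightarrow> ennreal" where
  "cum_weight w t = (case t of enat n \<Rightarrow> (\<Sum>k=1..n. ennreal (w k)) | \<infinity> \<Rightarrow> norm_1 w)"

end

theory Submission
  imports Defs
begin

text \<open>
  The p-values are iid uniform. Integrating out the randomizers turns \<open>\<phi>(p\<^sub>n)\<close> into a function
  \<open>\<psi>\<^sub>n(X\<^sub>1, \<dots>, X\<^sub>n)\<close> that is symmetric in its first \<open>n - 1\<close> arguments; exchangeability allows
  averaging it over the transpositions of \<open>k\<close> and \<open>n\<close>, and that average is the constant
  \<open>\<integral>\<phi>\<close>, because the intervals of values of the randomized ranks tile \<open>[0,1)\<close> with the right
  multiplicities. Peeling off \<open>n, n - 1, \<dots>\<close> gives the product formula for the expectation of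
  \<open>\<phi>\<^sub>1(p\<^sub>1) \<cdots> \<phi>\<^sub>n(p\<^sub>n)\<close>.

  A new p-value is thus independent of the past and every density integrates to one, so for \<open>Y\<close>
  measurable with respect to the past at time \<open>t\<close> one has \<open>E(Y S\<^sub>t\<^sub>+\<^sub>1) = E(Y (S\<^sub>t + w\<^sub>t\<^sub>+\<^sub>1))\<close>. This is the
  martingale property of \<open>S\<close> plus the remaining weight, and by induction it yields
  \<open>E S = E W\<close> at every bounded stopping time. Fatou's lemma passes to arbitrary stopping times,
  and the bounds on the alarms follow by Markov's inequality, as does everything for \<open>Z \<le> S\<close>.
\<close>

section \<open>Smoothed ranks\<close>

text \<open>The conformal p-value as a function of fixed data and one randomizer value, so that the
  randomizers can be integrated out while the data stay fixed.\<close>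

definition smoothed_rank :: "(nat \<Rightarrow> real) \<Rightarrow> nat \<Rightarrow> real \<Rightarrow> real" where
  "smoothed_rank x n l =
     ((\<Sum>i=1..n. of_bool (x i < x n)) + l * (\<Sum>i=1..n. of_bool (x i = x n))) / real n"

lemma conformal_p_eq_smoothed_rank:
  "conformal_p X lam n \<omega> = smoothed_rank (\<lambda>i. X i \<omega>) n (lam n \<omega>)"
  by (simp add: conformal_p_def smoothed_rank_def)

section \<open>Integrals against the uniform law\<close>

abbreviation unif :: "real measure" where
  "unif \<equiv> uniform_measure lborel {0<..<1}"

text \<open>The half-open interval is chosen to match the half-open rank intervals that tile it
  below; the endpoint 0 is a null set.\<close>

lemma nn_integral_unif:
  assumes "\<phi> \<in> borel_measurable borel"
  shows "(\<integral>\<^sup>+u. \<phi> u \<partial>unif) = (\<integral>\<^sup>+u. \<phi> u * indicator {0..<1} u \<partial>lborel)"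
proof -
  have "(\<integral>\<^sup>+u. \<phi> u \<partial>unif) = (\<integral>\<^sup>+u. \<phi> u * indicator {0<..<1} u \<partial>lborel)"
    using assms by (subst nn_integral_uniform_measure) (auto simp: divide_ennreal_def)
  also have "\<dots> = (\<integral>\<^sup>+u. \<phi> u * indicator {0..<1} u \<partial>lborel)"
    by (intro nn_integral_cong_AE, rule AE_mp[OF AE_lborel_singleton[of 0]]) (auto split: split_indicator)
  finally show ?thesis .
qed

lemma prob_space_unif: "prob_space unif"
  by (rule prob_space_uniform_measure) auto

text \<open>Substitution \<open>u = (a + l * m) / n\<close>: for fixed data the randomized rank is
  uniform on \<open>[a / n, (a + m) / n)\<close>, with density \<open>n / m\<close>. The indicator
  is written in terms of \<open>n * u\<close> so that its endpoints become plain counts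
  later.\<close>

lemma nn_integral_affine_piece:
  assumes [measurable]: "\<phi> \<in> borel_measurable borel" and "0 < m" "0 < n"
  shows "(\<integral>\<^sup>+l. \<phi> ((a + l * m) / n) \<partial>unif)
       = (\<integral>\<^sup>+u. \<phi> u * (ennreal (n / m) * indicator {a..<a+m} (n * u)) \<partial>lborel)"
proof -
  have "(\<integral>\<^sup>+u. \<phi> u * (ennreal (n / m) * indicator {a..<a+m} (n * u)) \<partial>lborel)
      = ennreal (m / n) * (\<integral>\<^sup>+l. \<phi> (a / n + m / n * l) *
          (ennreal (n / m) * indicator {a..<a+m} (n * (a / n + m / n * l))) \<partial>lborel)"
    using assms by (subst nn_integral_real_affine[where c="m/n" and t="a/n"]) auto
  also have "\<dots> = (\<integral>\<^sup>+l. ennreal (m / n) * (\<phi> (a / n + m / n * l) *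
          (ennreal (n / m) * indicator {a..<a+m} (n * (a / n + m / n * l)))) \<partial>lborel)"
    by (subst nn_integral_cmult) auto
  also have "\<dots> = (\<integral>\<^sup>+l. \<phi> ((a + l * m) / n) * indicator {0..<1} l \<partial>lborel)"
  proof (intro nn_integral_cong)
    fix l :: real
    have 1: "a / n + m / n * l = (a + l * m) / n" by (simp add: add_divide_distrib)
    have 2: "indicator {a..<a+m} (n * ((a + l * m) / n)) = (indicator {0..<1} l :: ennreal)"
      using assms by (auto split: split_indicator simp: zero_le_mult_iff)
    have "ennreal (m/n) * ennreal (n/m) = 1" using assms
      by (subst ennreal_mult[symmetric]) auto
    then show "ennreal (m / n) * (\<phi> (a / n + m / n * l) *
          (ennreal (n / m) * indicator {a..<a+m} (n * (a / n + m / n * l))))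
        = \<phi> ((a + l * m) / n) * indicator {0..<1} l"
      unfolding 1 2 by (metis (no_types, lifting) mult.assoc mult.commute mult.left_neutral)
  qed
  also have "\<dots> = (\<integral>\<^sup>+l. \<phi> ((a + l * m) / n) \<partial>unif)"
    by (subst nn_integral_unif) auto
  finally show ?thesis by simp
qed

section \<open>Rank intervals of a finite family tile the unit interval\<close>

context
  fixes x :: "'i \<Rightarrow> real" and I :: "'i set"
  assumes fin: "finite I"
begin

text \<open>Take \<open>k\<close> with the smallest value among the indices whose non-strict count
  exceeds \<open>v\<close>. Its strict count, if not zero, is the non-strict count of the next
  smaller value, which by minimality does not exceed \<open>v\<close>.\<close>

lemma order_statistic_exists:
  fixes v :: real
  assumes "0 \<le> v" "v < card I"
  obtains k where "k \<in> I" "card {i\<in>I. x i < x k} \<le> v" "v < card {i\<in>I. x i \<le> x k}"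
proof -
  let ?N = "\<lambda>k. card {i\<in>I. x i \<le> x k}"
  let ?K = "{k\<in>I. v < ?N k}"
  have "I \<noteq> {}" using assms by auto
  \<comment> \<open>A maximum of \<open>x\<close> is a minimum of \<open>- x\<close>; its non-strict
    count is \<open>card I\<close>, so \<open>?K\<close> is nonempty.\<close>
  then obtain m where m: "m \<in> I" "\<And>i. i \<in> I \<Longrightarrow> x i \<le> x m"
    using ex_is_arg_min_if_finite[OF fin, of "\<lambda>i. - x i"] by (force simp: is_arg_min_linorder)
  have "{i\<in>I. x i \<le> x m} = I" using m by auto
  then have "m \<in> ?K" using m assms by simp
  then obtain k where k: "k \<in> ?K" "\<And>j. j \<in> ?K \<Longrightarrow> x k \<le> x j"
    using ex_is_arg_min_if_finite[of ?K x] fin by (force simp: is_arg_min_linorder)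
  have "card {i\<in>I. x i < x k} \<le> v"
  proof (cases "{i\<in>I. x i < x k} = {}")
    case True then show ?thesis using assms by (metis card.empty of_nat_0)
  next
    case False
    let ?L = "{i\<in>I. x i < x k}"
    obtain j where j: "j \<in> ?L" "\<And>i. i \<in> ?L \<Longrightarrow> x i \<le> x j"
      using False ex_is_arg_min_if_finite[of ?L "\<lambda>i. - x i"] fin by (force simp: is_arg_min_linorder)
    have eq: "?L = {i\<in>I. x i \<le> x j}" using j by force
    have "j \<notin> ?K" using k j by force
    then have "\<not> v < ?N j" using j by auto
    then show ?thesis by (simp only: eq)
  qed
  then show ?thesis using that k by auto
qed

text \<open>The indices whose rank interval contains \<open>v\<close> form exactly one tie class,
  and each of its members contributes the reciprocal of its size.\<close>

lemma sum_inverse_tie_count: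
  fixes v :: real
  assumes v: "0 \<le> v" "v < card I"
  shows "(\<Sum>k\<in>I. of_bool (card {i\<in>I. x i < x k} \<le> v \<and> v < card {i\<in>I. x i \<le> x k})
           / card {i\<in>I. x i = x k}) = (1::real)"
proof -
  obtain k where k: "k \<in> I" "card {i\<in>I. x i < x k} \<le> v" "v < card {i\<in>I. x i \<le> x k}"
    using order_statistic_exists[OF v] .
  \<comment> \<open>Rank intervals of different values do not overlap: the upper end for the smaller
    value is at most the lower end for the larger one.\<close>
  have iff: "(card {i\<in>I. x i < x j} \<le> v \<and> v < card {i\<in>I. x i \<le> x j}) \<longleftrightarrow> x j = x k" if "j \<in> I" for j
  proof -
    have "card {i\<in>I. x i \<le> x j} \<le> card {i\<in>I. x i < x k}" if "x j < x k"
      using that fin by (intro card_mono) auto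
    moreover have "card {i\<in>I. x i \<le> x k} \<le> card {i\<in>I. x i < x j}" if "x k < x j"
      using that fin by (intro card_mono) auto
    moreover have ?thesis if "x j = x k" using k that by simp
    ultimately show ?thesis using k by (cases "x j" "x k" rule: linorder_cases) auto
  qed
  have "{i\<in>I. x i = x k} \<noteq> {}" using k by auto
  then have pos: "card {i\<in>I. x i = x k} > 0" using fin by (simp add: card_gt_0_iff)
  have "(\<Sum>j\<in>I. of_bool (card {i\<in>I. x i < x j} \<le> v \<and> v < card {i\<in>I. x i \<le> x j})
           / card {i\<in>I. x i = x j}) = (\<Sum>j\<in>I. of_bool (x j = x k) / real (card {i\<in>I. x i = x k}))"
    by (intro sum.cong refl) (auto simp: iff)
  also have "\<dots> = (\<Sum>j\<in>{i\<in>I. x i = x k}. 1 / real (card {i\<in>I. x i = x k}))"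
    using fin by (subst sum.inter_filter) (auto intro!: sum.cong)
  also have "\<dots> = 1" using pos by simp
  finally show ?thesis .
qed

text \<open>Averaging over the reference index \<open>k\<close> makes the smoothed rank uniform: the
  summand for \<open>k\<close> integrates \<open>\<phi>\<close> against the density
  \<open>n / m k\<close> on its rank interval, and these densities add up to \<open>n\<close> on
  \<open>[0,1)\<close>.\<close>

lemma sum_nn_integral_smoothed_rank:
  assumes [measurable]: "\<phi> \<in> borel_measurable borel"
  shows "(\<Sum>k\<in>I. \<integral>\<^sup>+l. \<phi> ((card {i\<in>I. x i < x k} + l * card {i\<in>I. x i = x k}) / card I) \<partial>unif)
       = of_nat (card I) * (\<integral>\<^sup>+u. \<phi> u \<partial>unif)"
proof (cases "I = {}")
  case False
  define a where "a k = real (card {i\<in>I. x i < x k})" for k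
  define m where "m k = real (card {i\<in>I. x i = x k})" for k
  define n where "n = real (card I)"
  have n: "n > 0" using False fin by (simp add: n_def card_gt_0_iff)
  have m: "m k > 0" if "k \<in> I" for k using that fin by (auto simp: m_def card_gt_0_iff)
  have am: "a k + m k = card {i\<in>I. x i \<le> x k}" for k
  proof -
    have "{i\<in>I. x i \<le> x k} = {i\<in>I. x i < x k} \<union> {i\<in>I. x i = x k}" by auto
    then show ?thesis using fin unfolding a_def m_def
      by (simp only: of_nat_add[symmetric]) (subst card_Un_disjoint, auto)
  qed
  have am_le: "a k + m k \<le> n" for k
    unfolding am n_def using fin by (auto intro!: card_mono)
  have a_nonneg: "0 \<le> a k" for k by (simp add: a_def)
  have key: "(\<Sum>k\<in>I. ennreal (n / m k) * indicator {a k..<a k + m k} (n * u)) = ennreal n * indicator {0..<1} u" for u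
  proof (cases "u \<in> {0..<1}")
    case True
    then have v: "0 \<le> n * u" "n * u < card I" using n by (auto simp: n_def[symmetric])
    have "(\<Sum>k\<in>I. ennreal (n / m k) * indicator {a k..<a k + m k} (n * u))
        = (\<Sum>k\<in>I. ennreal (n * (of_bool (a k \<le> n * u \<and> n * u < a k + m k) / m k)))"
      by (intro sum.cong refl) (auto split: split_indicator)
    also have "\<dots> = ennreal (n * (\<Sum>k\<in>I. of_bool (a k \<le> n * u \<and> n * u < a k + m k) / m k))"
      using n m by (subst sum_ennreal) (auto simp: sum_distrib_left less_imp_le)
    also have "(\<Sum>k\<in>I. of_bool (a k \<le> n * u \<and> n * u < a k + m k) / m k) = 1"
      using sum_inverse_tie_count[OF v] unfolding am unfolding a_def m_def .
    finally show ?thesis using True by simp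
  next
    \<comment> \<open>All rank intervals lie in \<open>[0,n)\<close>, so none contains
      \<open>n * u\<close> when \<open>u\<close> is outside \<open>[0,1)\<close>.\<close>
    case False
    have "n * u \<notin> {a k..<a k + m k}" for k
    proof
      assume "n * u \<in> {a k..<a k + m k}"
      then have "a k \<le> n * u" "n * u < a k + m k" by auto
      then have "0 \<le> n * u" "n * u < n" using am_le[of k] a_nonneg[of k] by linarith+
      then show False using False n by (simp add: zero_le_mult_iff)
    qed
    then show ?thesis using False by simp
  qed
  have "(\<Sum>k\<in>I. \<integral>\<^sup>+l. \<phi> ((a k + l * m k) / n) \<partial>unif)
      = (\<Sum>k\<in>I. \<integral>\<^sup>+u. \<phi> u * (ennreal (n / m k) * indicator {a k..<a k+m k} (n * u)) \<partial>lborel)"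
    using m n by (intro sum.cong refl nn_integral_affine_piece) auto
  also have "\<dots> = (\<integral>\<^sup>+u. (\<Sum>k\<in>I. \<phi> u * (ennreal (n / m k) * indicator {a k..<a k+m k} (n * u))) \<partial>lborel)"
    by (subst nn_integral_sum) auto
  also have "\<dots> = (\<integral>\<^sup>+u. ennreal n * (\<phi> u * indicator {0..<1} u) \<partial>lborel)"
    unfolding sum_distrib_left[symmetric] key by (simp add: mult_ac)
  also have "\<dots> = ennreal n * (\<integral>\<^sup>+u. \<phi> u \<partial>unif)"
    by (subst nn_integral_cmult) (auto simp: nn_integral_unif)
  finally show ?thesis by (simp add: a_def m_def n_def ennreal_of_nat_eq_real_of_nat)
qed simp

end

section \<open>Symmetrization over exchangeable data\<close>

lemma smoothed_rank_cong:
  "(\<And>j. j \<in> {1..n} \<Longrightarrow> x j = y j) \<Longrightarrow> smoothed_rank x n l = smoothed_rank y n l"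
  \<comment> \<open>For \<open>n = 0\<close> the sums are empty, so the value at index 0 does not
    matter; otherwise \<open>n\<close> lies in \<open>{1..n}\<close>.\<close>
  by (cases "n = 0") (simp_all add: smoothed_rank_def)

text \<open>Counting over all of \<open>{1..n}\<close> is insensitive to relabelling, so only the
  reference value \<open>x (\<pi> n)\<close> changes.\<close>

lemma smoothed_rank_permute:
  fixes l :: real
  assumes "\<pi> permutes {1..n}"
  shows "smoothed_rank (x \<circ> \<pi>) n l =
    (card {i\<in>{1..n}. x i < x (\<pi> n)} + l * card {i\<in>{1..n}. x i = x (\<pi> n)}) / card {1..n}"
proof -
  have "(\<Sum>i=1..n. of_bool (P (\<pi> i))) = real (card {i\<in>{1..n}. P i})" for P
  proof -
    have "{1..n} \<inter> {i. P i} = {i\<in>{1..n}. P i}" by auto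
    then have "(\<Sum>i=1..n. of_bool (P i)) = real (card {i\<in>{1..n}. P i})"
      by (simp add: sum_of_bool_eq)
    then show ?thesis
      using sum.permute[OF assms, of "\<lambda>i. of_bool (P i) :: real"] by (simp add: comp_def)
  qed
  from this[of "\<lambda>i. x i < x (\<pi> n)"] this[of "\<lambda>i. x i = x (\<pi> n)"] show ?thesis
    unfolding smoothed_rank_def comp_def by simp
qed

lemma measurable_smoothed_rank:
  assumes "i \<in> {1..N}"
  shows "(\<lambda>(x, l). smoothed_rank x i l) \<in> borel_measurable (PiM {1..N} (\<lambda>_. borel) \<Otimes>\<^sub>M borel)"
proof -
  have [measurable]: "(\<lambda>z. fst z j) \<in> borel_measurable (PiM {1..N} (\<lambda>_. borel) \<Otimes>\<^sub>M borel)"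
    if "j \<in> {1..i}" for j using that assms
    by (intro measurable_compose[OF measurable_fst measurable_component_singleton]) auto
  have [measurable]: "(\<lambda>z. fst z i) \<in> borel_measurable (PiM {1..N} (\<lambda>_. borel) \<Otimes>\<^sub>M borel)"
    using assms by auto
  show ?thesis
    unfolding smoothed_rank_def case_prod_beta of_bool_def by measurable
qed

text \<open>Induction removes the factor of the largest index and moves it into the weight
  \<open>g\<close>. The invariance of \<open>g\<close> allows the averaging over reference indices,
  and the enlarged weight keeps the invariance under the smaller permutation group that the next
  step needs.\<close>

lemma nn_integral_smoothed_ranks_exchangeable:
  fixes \<mu> :: "(nat \<Rightarrow> real) measure"
  assumes sets_\<mu>: "sets \<mu> = sets (PiM {1..N} (\<lambda>_. borel))"
    and exch: "\<And>\<pi>. \<pi> permutes {1..N} \<Longrightarrow>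
      distr \<mu> (PiM {1..N} (\<lambda>_. borel)) (\<lambda>x. \<lambda>i\<in>{1..N}. x (\<pi> i)) = \<mu>"
    and \<phi>: "\<And>i. \<phi> i \<in> borel_measurable borel"
    and "n \<le> N" "g \<in> borel_measurable \<mu>"
    and "\<And>\<pi> x. \<pi> permutes {1..n} \<Longrightarrow> x \<in> space \<mu> \<Longrightarrow> g (\<lambda>i\<in>{1..N}. x (\<pi> i)) = g x"
  shows "(\<integral>\<^sup>+x. g x * (\<Prod>i=1..n. \<integral>\<^sup>+l. \<phi> i (smoothed_rank x i l) \<partial>unif) \<partial>\<mu>)
       = (\<integral>\<^sup>+x. g x \<partial>\<mu>) * (\<Prod>i=1..n. \<integral>\<^sup>+u. \<phi> i u \<partial>unif)"
  using assms(4-)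
proof (induction n arbitrary: g)
  case (Suc n g)
  note [measurable] = \<phi> Suc.prems(2)
  let ?P = "PiM {1..N} (\<lambda>_. borel :: real measure)"
  let ?sh = "\<lambda>\<pi> x. \<lambda>i\<in>{1..N}. x (\<pi> i)"
  define m where "m = Suc n"
  have m: "m \<in> {1..N}" using Suc.prems by (simp add: m_def)
  define c where "c = (\<integral>\<^sup>+u. \<phi> m u \<partial>unif)"
  define \<psi> where "\<psi> = (\<lambda>x. \<integral>\<^sup>+l. \<phi> m (smoothed_rank x m l) \<partial>unif)"
  \<comment> \<open>\<open>J k\<close> is the last factor with the reference index \<open>m\<close>
    replaced by \<open>k\<close>.\<close>
  define J where "J k x = (\<integral>\<^sup>+l. \<phi> m ((card {i\<in>{1..m}. x i < x k} +
      l * card {i\<in>{1..m}. x i = x k}) / card {1..m}) \<partial>unif)"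
    for k and x :: "nat \<Rightarrow> real"
  interpret U: prob_space unif by (rule prob_space_unif)
  have "(\<lambda>(x, l). \<phi> m (smoothed_rank x m l)) \<in> borel_measurable (?P \<Otimes>\<^sub>M unif)"
    using measurable_compose[OF measurable_smoothed_rank[OF m] \<phi>]
    by (subst measurable_cong_sets[OF sets_pair_measure_cong[of _ ?P _ borel] refl])
      (auto simp: case_prod_beta)
  then have \<psi>_P: "\<psi> \<in> borel_measurable ?P"
    unfolding \<psi>_def by (rule U.borel_measurable_nn_integral)
  then have [measurable]: "\<psi> \<in> borel_measurable \<mu>"
    by (simp cong: measurable_cong_sets add: sets_\<mu>)
  have sh: "\<psi> (?sh \<pi> x) = J (\<pi> m) x" if "\<pi> permutes {1..m}" for x \<pi>
  proof -
    have "smoothed_rank (?sh \<pi> x) m l = smoothed_rank (x \<circ> \<pi>) m l" for l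
      using m by (intro smoothed_rank_cong) auto
    note * = trans[OF this smoothed_rank_permute[OF that]]
    show ?thesis unfolding \<psi>_def J_def * ..
  qed
  have \<psi>_eq: "\<psi> x = J m x" for x
    using smoothed_rank_permute[of id m x] unfolding \<psi>_def J_def by (simp add: permutes_id)
  \<comment> \<open>Permutations of the first \<open>n\<close> indices fix \<open>m\<close>, so
    multiplying by \<open>\<psi>\<close> preserves the invariance that the induction hypothesis asks
    of the weight.\<close>
  have sym: "g (?sh \<pi> x) * \<psi> (?sh \<pi> x) = g x * \<psi> x" if "\<pi> permutes {1..n}" "x \<in> space \<mu>" for \<pi> x
  proof -
    have \<pi>: "\<pi> permutes {1..m}" using that by (auto intro: permutes_subset simp: m_def)
    have "\<pi> m = m" using that by (auto simp: m_def permutes_not_in)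
    then show ?thesis
      unfolding sh[OF \<pi>] unfolding \<psi>_eq using Suc.prems(3)[OF \<pi>[unfolded m_def] that(2)] by (simp only:)
  qed
  \<comment> \<open>The transposition of \<open>k\<close> and \<open>m\<close> preserves
    \<open>\<mu>\<close> and \<open>g\<close> but turns \<open>\<psi>\<close> into
    \<open>J k\<close>.\<close>
  have swap: "(\<integral>\<^sup>+x. g x * \<psi> x \<partial>\<mu>) = (\<integral>\<^sup>+x. g x * J k x \<partial>\<mu>)"
    and J_meas: "J k \<in> borel_measurable \<mu>" if k: "k \<in> {1..m}" for k
  proof -
    let ?t = "Transposition.transpose k m"
    have t: "?t permutes {1..m}" using k by (intro permutes_swap_id) auto
    then have tN: "?t permutes {1..N}" by (rule permutes_subset) (use m in auto)
    have "?sh ?t \<in> measurable ?P ?P"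
      using permutes_in_image[OF tN] by (intro measurable_restrict measurable_component_singleton) auto
    then have [measurable]: "?sh ?t \<in> measurable \<mu> ?P"
      by (simp cong: measurable_cong_sets add: sets_\<mu>)
    have J: "J k = (\<lambda>x. \<psi> (?sh ?t x))"
      unfolding sh[OF t] by simp
    show "J k \<in> borel_measurable \<mu>"
      unfolding J using \<open>?sh ?t \<in> measurable \<mu> ?P\<close> \<psi>_P by (rule measurable_compose)
    have "g \<in> borel_measurable ?P"
      using Suc.prems(2) unfolding measurable_cong_sets[OF sets_\<mu> refl] .
    then have g\<psi>: "(\<lambda>x. g x * \<psi> x) \<in> borel_measurable (distr \<mu> ?P (?sh ?t))"
      using \<psi>_P by (simp only: measurable_distr_eq1) (rule borel_measurable_times_ennreal)
    have "(\<integral>\<^sup>+x. g x * \<psi> x \<partial>distr \<mu> ?P (?sh ?t)) = (\<integral>\<^sup>+x. g (?sh ?t x) * \<psi> (?sh ?t x) \<partial>\<mu>)"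
      by (rule nn_integral_distr[OF _ g\<psi>]) fact
    also have "\<dots> = (\<integral>\<^sup>+x. g x * J k x \<partial>\<mu>)"
    proof (rule nn_integral_cong)
      fix x assume "x \<in> space \<mu>"
      note Suc.prems(3)[of ?t x, folded m_def, OF t this]
      then show "g (?sh ?t x) * \<psi> (?sh ?t x) = g x * J k x"
        unfolding sh[OF t] by (simp only: transpose_apply_second)
    qed
    finally show "(\<integral>\<^sup>+x. g x * \<psi> x \<partial>\<mu>) = (\<integral>\<^sup>+x. g x * J k x \<partial>\<mu>)" unfolding exch[OF tN] .
  qed
  \<comment> \<open>Averaging over the \<open>m\<close> choices of \<open>k\<close> replaces
    \<open>\<psi>\<close> by the constant \<open>c\<close>; the factor \<open>m\<close> is finite
    and nonzero, so it cancels at the end.\<close>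
  have "of_nat m * (\<integral>\<^sup>+x. g x * \<psi> x \<partial>\<mu>) = (\<Sum>k=1..m. \<integral>\<^sup>+x. g x * \<psi> x \<partial>\<mu>)" by simp
  also have "\<dots> = (\<Sum>k=1..m. \<integral>\<^sup>+x. g x * J k x \<partial>\<mu>)"
    by (intro sum.cong refl swap)
  also have "\<dots> = (\<integral>\<^sup>+x. (\<Sum>k=1..m. g x * J k x) \<partial>\<mu>)"
    using J_meas by (intro nn_integral_sum[symmetric] borel_measurable_times_ennreal Suc.prems(2))
  also have "\<dots> = (\<integral>\<^sup>+x. g x * (of_nat (card {1..m}) * c) \<partial>\<mu>)"
    unfolding sum_distrib_left[symmetric] c_def J_def
    by (subst sum_nn_integral_smoothed_rank) auto
  also have "\<dots> = of_nat m * ((\<integral>\<^sup>+x. g x \<partial>\<mu>) * c)"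
    by (subst nn_integral_multc) (auto simp: mult_ac)
  finally have step: "(\<integral>\<^sup>+x. g x * \<psi> x \<partial>\<mu>) = (\<integral>\<^sup>+x. g x \<partial>\<mu>) * c"
    by (subst (asm) ennreal_mult_cancel_left) (auto simp: m_def)
  have "(\<integral>\<^sup>+x. g x * (\<Prod>i=1..Suc n. \<integral>\<^sup>+l. \<phi> i (smoothed_rank x i l) \<partial>unif) \<partial>\<mu>)
      = (\<integral>\<^sup>+x. (g x * \<psi> x) * (\<Prod>i=1..n. \<integral>\<^sup>+l. \<phi> i (smoothed_rank x i l) \<partial>unif) \<partial>\<mu>)"
    by (intro nn_integral_cong) (simp add: \<psi>_def m_def mult_ac)
  also have "\<dots> = (\<integral>\<^sup>+x. g x * \<psi> x \<partial>\<mu>) * (\<Prod>i=1..n. \<integral>\<^sup>+u. \<phi> i u \<partial>unif)"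
  proof (rule Suc.IH)
    show "n \<le> N" using Suc.prems(1) by simp
    show "(\<lambda>x. g x * \<psi> x) \<in> borel_measurable \<mu>" by measurable
  qed (rule sym)
  also have "\<dots> = (\<integral>\<^sup>+x. g x \<partial>\<mu>) * (\<Prod>i=1..Suc n. \<integral>\<^sup>+u. \<phi> i u \<partial>unif)"
    unfolding step by (simp add: c_def m_def mult_ac)
  finally show ?case .
qed simp


section \<open>Conformal p-values are iid uniform\<close>

context prob_space
begin

text \<open>Restriction to the coordinates in \<open>I\<close> is measurable, so independence of the
  whole sequences passes to the restricted ones, whose joint law is then a product.\<close>

lemma indep_sequences_joint_distr:
  assumes "indep_sequences M X Y" "I \<subseteq> {1..}"
  shows "distr M (PiM I (\<lambda>_. borel)) (\<lambda>\<omega>. \<lambda>j\<in>I. X j \<omega>) \<Otimes>\<^sub>M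
      distr M (PiM I (\<lambda>_. borel)) (\<lambda>\<omega>. \<lambda>j\<in>I. Y j \<omega>) =
      distr M (PiM I (\<lambda>_. borel) \<Otimes>\<^sub>M PiM I (\<lambda>_. borel))
        (\<lambda>\<omega>. (\<lambda>j\<in>I. X j \<omega>, \<lambda>j\<in>I. Y j \<omega>))"
proof -
  have "(\<lambda>x. restrict x I) \<in> measurable (PiM {1..} (\<lambda>_. borel)) (PiM I (\<lambda>_. borel :: real measure))"
    using assms(2) by (intro measurable_restrict_subset)
  from indep_var_compose[OF assms(1)[unfolded indep_sequences_def] this this]
  have "indep_var (PiM I (\<lambda>_. borel)) (\<lambda>\<omega>. \<lambda>j\<in>I. X j \<omega>) (PiM I (\<lambda>_. borel)) (\<lambda>\<omega>. \<lambda>j\<in>I. Y j \<omega>)"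
    using assms(2) by (simp add: comp_def restrict_restrict Int_absorb1)
  then show ?thesis by (simp add: indep_var_distribution_eq)
qed

lemma iid_uniform_distr:
  assumes "iid_uniform M lam" "I \<subseteq> {1..}" "finite I" "I \<noteq> {}"
  shows "distr M (PiM I (\<lambda>_. borel)) (\<lambda>\<omega>. \<lambda>j\<in>I. lam j \<omega>) = PiM I (\<lambda>_. unif)"
proof -
  have ind: "indep_vars (\<lambda>_. borel) lam I" and U: "\<And>j. j \<ge> 1 \<Longrightarrow> distr M borel (lam j) = unif"
    using assms by (auto simp: iid_uniform_def intro: indep_vars_subset)
  have "distr M (PiM I (\<lambda>_. borel)) (\<lambda>\<omega>. \<lambda>j\<in>I. lam j \<omega>) = PiM I (\<lambda>j. distr M borel (lam j))"
    using ind assms by (subst indep_vars_iff_distr_eq_PiM'[symmetric]) (auto simp: indep_vars_def2)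
  also have "\<dots> = PiM I (\<lambda>_. unif)"
    using U assms by (intro PiM_cong) auto
  finally show ?thesis .
qed

text \<open>For fixed data each p-value depends on its own randomizer alone. Fubini therefore
  integrates the randomizers first, factor by factor, and symmetrization handles the data. Stated
  for arbitrary nonnegative test functions, the formula contains both independence and
  uniformity.\<close>

lemma nn_integral_prod_conformal_p:
  assumes exch: "exchangeable M X" and iid: "iid_uniform M lam" and ind: "indep_sequences M X lam"
    and \<phi>: "\<And>i. \<phi> i \<in> borel_measurable borel"
  shows "(\<integral>\<^sup>+\<omega>. (\<Prod>i=1..n. \<phi> i (conformal_p X lam i \<omega>)) \<partial>M) = (\<Prod>i=1..n. \<integral>\<^sup>+u. \<phi> i u \<partial>unif)"
proof (cases "n = 0")
  case False
  note [measurable] = \<phi>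
  let ?P = "PiM {1..n} (\<lambda>_. borel :: real measure)"
  let ?X = "\<lambda>\<omega>. \<lambda>j\<in>{1..n}. X j \<omega>" and ?L = "\<lambda>\<omega>. \<lambda>j\<in>{1..n}. lam j \<omega>"
  let ?F = "\<lambda>(x, l). \<Prod>i=1..n. \<phi> i (smoothed_rank x i (l i))"
  have X[measurable]: "X j \<in> borel_measurable M" if "j \<in> {1..n}" for j
    using exch that by (auto simp: exchangeable_def)
  have [measurable]: "lam j \<in> borel_measurable M" if "j \<in> {1..n}" for j
    using iid that by (auto simp: iid_uniform_def indep_vars_def2)
  have XL[measurable]: "?X \<in> measurable M ?P" "?L \<in> measurable M ?P" by measurable
  have F: "?F \<in> borel_measurable (?P \<Otimes>\<^sub>M ?P)"
  proof -
    have "(\<lambda>z. smoothed_rank (fst z) i (snd z i)) \<in> borel_measurable (?P \<Otimes>\<^sub>M ?P)" if i: "i \<in> {1..n}" for i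
    proof -
      have "(\<lambda>z. (fst z, snd z i)) \<in> measurable (?P \<Otimes>\<^sub>M ?P) (?P \<Otimes>\<^sub>M borel)"
        using i by measurable
      from measurable_compose[OF this measurable_smoothed_rank[OF i]] show ?thesis by simp
    qed
    then have "(\<lambda>z. \<phi> i (smoothed_rank (fst z) i (snd z i))) \<in> borel_measurable (?P \<Otimes>\<^sub>M ?P)"
      if "i \<in> {1..n}" for i using that by (intro measurable_compose[OF _ \<phi>])
    then show ?thesis
      unfolding case_prod_beta by (rule borel_measurable_prod_ennreal)
  qed
  define \<mu> where "\<mu> = distr M ?P ?X"
  interpret \<mu>: prob_space \<mu> unfolding \<mu>_def by (rule prob_space_distr) measurable
  interpret U: product_prob_space "\<lambda>_::nat. unif"
    by (intro product_prob_spaceI prob_space_unif)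
  interpret UI: prob_space "PiM {1..n} (\<lambda>_. unif)" by (intro prob_space_PiM prob_space_unif)
  have sets_\<mu>: "sets \<mu> = sets ?P" by (simp add: \<mu>_def)
  have sets_U: "sets (PiM {1..n} (\<lambda>_. unif)) = sets ?P" by (intro sets_PiM_cong) auto
  \<comment> \<open>Exchangeability of \<open>X\<close>, transported to its law \<open>\<mu>\<close>
    on the coordinate space.\<close>
  have "distr \<mu> ?P (\<lambda>x. \<lambda>i\<in>{1..n}. x (\<pi> i)) = \<mu>" if \<pi>: "\<pi> permutes {1..n}" for \<pi>
  proof -
    have "(\<lambda>x. \<lambda>i\<in>{1..n}. x (\<pi> i)) \<in> measurable ?P ?P"
      using permutes_in_image[OF \<pi>] by (intro measurable_restrict measurable_component_singleton) auto
    then have "distr \<mu> ?P (\<lambda>x. \<lambda>i\<in>{1..n}. x (\<pi> i)) = distr M ?P ((\<lambda>x. \<lambda>i\<in>{1..n}. x (\<pi> i)) \<circ> ?X)"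
      unfolding \<mu>_def using XL by (intro distr_distr)
    also have "(\<lambda>x. \<lambda>i\<in>{1..n}. x (\<pi> i)) \<circ> ?X = (\<lambda>\<omega>. \<lambda>i\<in>{1..n}. X (\<pi> i) \<omega>)"
      using permutes_in_image[OF \<pi>] by (auto simp: fun_eq_iff restrict_def)
    also have "distr M ?P \<dots> = \<mu>"
      using exch \<pi> by (auto simp: exchangeable_def \<mu>_def)
    finally show ?thesis .
  qed
  note sym = nn_integral_smoothed_ranks_exchangeable[OF sets_\<mu> this \<phi> order.refl, of "\<lambda>_. 1"]
  have "(\<integral>\<^sup>+\<omega>. (\<Prod>i=1..n. \<phi> i (conformal_p X lam i \<omega>)) \<partial>M) = (\<integral>\<^sup>+\<omega>. ?F (?X \<omega>, ?L \<omega>) \<partial>M)"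
    unfolding conformal_p_eq_smoothed_rank
    by (intro nn_integral_cong) (auto intro!: prod.cong arg_cong[where f="\<phi> _"] smoothed_rank_cong)
  also have "\<dots> = (\<integral>\<^sup>+z. ?F z \<partial>distr M (?P \<Otimes>\<^sub>M ?P) (\<lambda>\<omega>. (?X \<omega>, ?L \<omega>)))"
    using F by (subst nn_integral_distr) auto
  also have "distr M (?P \<Otimes>\<^sub>M ?P) (\<lambda>\<omega>. (?X \<omega>, ?L \<omega>)) = \<mu> \<Otimes>\<^sub>M PiM {1..n} (\<lambda>_. unif)"
    using indep_sequences_joint_distr[OF ind, of "{1..n}"] iid_uniform_distr[OF iid, of "{1..n}"] False
    by (simp add: \<mu>_def Suc_le_eq)
  also have "(\<integral>\<^sup>+z. ?F z \<partial>(\<mu> \<Otimes>\<^sub>M PiM {1..n} (\<lambda>_. unif)))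
      = (\<integral>\<^sup>+x. \<integral>\<^sup>+l. (\<Prod>i=1..n. \<phi> i (smoothed_rank x i (l i))) \<partial>PiM {1..n} (\<lambda>_. unif) \<partial>\<mu>)"
    using F by (subst UI.nn_integral_fst[symmetric])
      (simp_all cong: measurable_cong_sets sets_pair_measure_cong add: sets_\<mu> sets_U)
  also have "\<dots> = (\<integral>\<^sup>+x. (\<Prod>i=1..n. \<integral>\<^sup>+l. \<phi> i (smoothed_rank x i l) \<partial>unif) \<partial>\<mu>)"
    by (intro nn_integral_cong U.product_nn_integral_prod) (auto simp: smoothed_rank_def)
  also have "\<dots> = (\<Prod>i=1..n. \<integral>\<^sup>+u. \<phi> i u \<partial>unif)"
    using sym by (simp add: \<mu>.emeasure_space_1)
  finally show ?thesis .
qed (simp add: emeasure_space_1)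

lemma measurable_conformal_p:
  assumes exch: "exchangeable M X" and iid: "iid_uniform M lam" and "1 \<le> i"
  shows "conformal_p X lam i \<in> borel_measurable M"
proof -
  have [measurable]: "X j \<in> borel_measurable M" "lam j \<in> borel_measurable M" if "j \<in> {1..i}" for j
    using assms that by (auto simp: exchangeable_def iid_uniform_def indep_vars_def2)
  have [measurable]: "X i \<in> borel_measurable M" "lam i \<in> borel_measurable M"
    using assms by (auto simp: exchangeable_def iid_uniform_def indep_vars_def2)
  show ?thesis unfolding conformal_p_def of_bool_def by measurable
qed

end

section \<open>Filtration, stopping and weights\<close>

lemma space_p_filtration [simp]: "space (p_filtration M p t) = space M"
  by (simp add: p_filtration_def space_measure_of_conv)

lemma sets_p_filtration:
  "sets (p_filtration M p t) =
     sigma_sets (space M) {p i -` A \<inter> space M | i A. 1 \<le> i \<and> enat i \<le> t \<and> A \<in> sets borel}"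
  by (auto simp: p_filtration_def intro!: sets_measure_of)

lemma measurable_p_filtration:
  assumes "1 \<le> i" "enat i \<le> t"
  shows "p i \<in> borel_measurable (p_filtration M p t)"
  using assms by (intro measurableI) (auto simp: sets_p_filtration intro!: sigma_sets.Basic)

lemma filtration_p_filtration: "filtration (space M) (p_filtration M p)"
proof
  show "sets (p_filtration M p s) \<subseteq> sets (p_filtration M p t)" if "s \<le> t" for s t
    unfolding sets_p_filtration using that by (intro sigma_sets_mono') (auto intro: order_trans)
qed simp

section \<open>Stopping at truncated times\<close>

lemma min_enat_0: "min t (enat 0) = enat 0"
  by (cases t) auto

text \<open>Both this and \<open>stopped_min_split\<close> split on whether \<open>T\<close> has
  occurred by time \<open>m\<close>, which is known at time \<open>m\<close>. Comparing the two
  isolates the change from \<open>D m\<close> to \<open>D (Suc m)\<close> on the event of not having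
  stopped.\<close>

lemma stopped_min_Suc:
  "stopped D (\<lambda>\<omega>. min (T \<omega>) (enat (Suc m))) \<omega> =
     indicator {\<omega>. T \<omega> \<le> enat m} \<omega> * stopped D (\<lambda>\<omega>. min (T \<omega>) (enat m)) \<omega> +
     indicator {\<omega>. enat m < T \<omega>} \<omega> * D (Suc m) \<omega>"
  by (cases "T \<omega>") (auto simp: stopped_def min_def not_le le_Suc_eq split: split_indicator)

lemma stopped_min_split:
  "stopped D (\<lambda>\<omega>. min (T \<omega>) (enat m)) \<omega> =
     indicator {\<omega>. T \<omega> \<le> enat m} \<omega> * stopped D (\<lambda>\<omega>. min (T \<omega>) (enat m)) \<omega> +
     indicator {\<omega>. enat m < T \<omega>} \<omega> * D m \<omega>"
  by (cases "T \<omega>") (auto simp: stopped_def min_def not_le split: split_indicator)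

lemma cum_weight_min_Suc:
  "cum_weight w (min T (enat (Suc m))) =
     cum_weight w (min T (enat m)) + of_bool (enat m < T) * ennreal (w (Suc m))"
proof (cases "enat m < T")
  case True
  then have "min T (enat m) = enat m" "min T (enat (Suc m)) = enat (Suc m)"
    by (simp_all add: min_absorb2 Suc_ile_eq)
  then show ?thesis using True by (simp add: cum_weight_def)
next
  case False
  then have "min T (enat m) = T" "min T (enat (Suc m)) = T"
    by (auto simp: min_def not_less intro: order_trans)
  then show ?thesis using False by simp
qed

text \<open>For finite \<open>T\<close> the truncated values are eventually constant, and for
  infinite \<open>T\<close> this is the definition of \<open>stopped\<close>. Fatou's lemma is
  applied to this form.\<close>

lemma stopped_eq_liminf_stopped_min:
  "stopped D T \<omega> = liminf (\<lambda>m. stopped D (\<lambda>\<omega>. min (T \<omega>) (enat m)) \<omega>)"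
proof (cases "T \<omega>")
  case (enat n)
  have "eventually (\<lambda>m. stopped D (\<lambda>\<omega>. min (T \<omega>) (enat m)) \<omega> = stopped D T \<omega>) sequentially"
    using eventually_ge_at_top[of n] by eventually_elim (simp add: stopped_def enat)
  then have "(\<lambda>m. stopped D (\<lambda>\<omega>. min (T \<omega>) (enat m)) \<omega>) \<longlonglongrightarrow> stopped D T \<omega>"
    by (rule tendsto_eventually)
  then show ?thesis by (intro lim_imp_Liminf[symmetric]) auto
next
  case infinity
  then show ?thesis by (simp add: stopped_def)
qed

lemma stopped_mono:
  assumes "\<And>t. D t \<omega> \<le> E t \<omega>"
  shows "stopped D T \<omega> \<le> stopped E T \<omega>"
  using assms by (auto simp: stopped_def split: enat.split intro!: Liminf_mono always_eventually)

section \<open>Alarm times\<close>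

lemma alarm_eq_enatD:
  assumes "alarm D b \<omega> = enat n"
  shows "1 \<le> n" "ennreal b \<le> D n \<omega>"
proof -
  let ?A = "{enat t | t. 1 \<le> t \<and> ennreal b \<le> D t \<omega>}"
  \<comment> \<open>\<open>Inf {} = \<infinity>\<close> rules out the empty set; by well-ordering
    the infimum is then attained.\<close>
  have "?A \<noteq> {}" using assms by (auto simp: alarm_def Inf_enat_def split: if_splits)
  then have "Inf ?A \<in> ?A" unfolding Inf_enat_def by (auto intro: LeastI2)
  then show "1 \<le> n" "ennreal b \<le> D n \<omega>" using assms by (auto simp: alarm_def)
qed

text \<open>The infimum is attained, so the event reduces to finitely many threshold events; this is
  what makes an alarm a stopping time.\<close>

lemma alarm_le_iff:
  "alarm D b \<omega> \<le> enat n \<longleftrightarrow> (\<exists>t\<in>{1..n}. ennreal b \<le> D t \<omega>)"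
proof
  assume le: "alarm D b \<omega> \<le> enat n"
  then obtain k where "alarm D b \<omega> = enat k" by (cases "alarm D b \<omega>") auto
  with alarm_eq_enatD[OF this] le show "\<exists>t\<in>{1..n}. ennreal b \<le> D t \<omega>" by auto
next
  assume "\<exists>t\<in>{1..n}. ennreal b \<le> D t \<omega>"
  then obtain t where "1 \<le> t" "t \<le> n" "ennreal b \<le> D t \<omega>" by auto
  then show "alarm D b \<omega> \<le> enat n"
    unfolding alarm_def by (intro Inf_lower2[of "enat t"]) auto
qed

lemma stopping_time_alarm:
  assumes "filtration \<Omega> F" "\<And>t. D t \<in> borel_measurable (F (enat t))"
  shows "stopping_time F (alarm D b)"
proof
  interpret filtration \<Omega> F by fact
  fix t show "Measurable.pred (F t) (\<lambda>\<omega>. alarm D b \<omega> \<le> t)"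
  proof (cases t)
    case (enat n)
    have [measurable]: "D s \<in> borel_measurable (F (enat n))" if "s \<in> {1..n}" for s
      using that sets_F_mono[of "enat s" "enat n"]
      by (intro subsetD[OF measurable_mono assms(2)[of s]]) (auto simp: space_F)
    show ?thesis unfolding enat alarm_le_iff by measurable
  \<comment> \<open>At \<open>t = \<infinity>\<close> the predicate is constantly true.\<close>
  qed simp
qed

section \<open>Cumulative and remaining weights\<close>

lemma weight_tail_Suc: "weight_tail w t = ennreal (w (Suc t)) + weight_tail w (Suc t)"
  using suminf_offset[of "\<lambda>i. ennreal (w (t + 1 + i))" 1] by (simp add: weight_tail_def add.commute)

lemma weight_tail_0: "weight_tail w 0 = norm_1 w"
  by (simp add: weight_tail_def norm_1_def add.commute)

lemma cum_weight_le_norm_1: "cum_weight w t \<le> norm_1 w"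
proof (cases t)
  case (enat n)
  have "(\<Sum>k=1..n. ennreal (w k)) = (\<Sum>i<n. ennreal (w (i + 1)))"
    by (rule sum.reindex_bij_witness[of _ "\<lambda>i. i + 1" "\<lambda>i. i - 1"]) auto
  then show ?thesis
    unfolding enat cum_weight_def norm_1_def by (auto intro!: sum_le_suminf)
qed (simp add: cum_weight_def)

lemma cum_weight_mono:
  assumes "s \<le> t"
  shows "cum_weight w s \<le> cum_weight w t"
proof (cases t)
  case t: (enat n)
  then obtain m where "s = enat m" "m \<le> n" using assms by (cases s) auto
  then show ?thesis using t by (auto simp: cum_weight_def intro!: sum_mono2)
qed (use cum_weight_le_norm_1 in \<open>auto simp: cum_weight_def[of _ \<infinity>]\<close>)

lemma cum_weight_le_norm_inf:
  assumes "0 < norm_inf w"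
  shows "cum_weight w t \<le> norm_inf w * ennreal_of_enat t"
proof (cases t)
  case (enat n)
  have "(\<Sum>k=1..n. ennreal (w k)) \<le> (\<Sum>k=1..n. norm_inf w)"
    unfolding norm_inf_def by (intro sum_mono SUP_upper) auto
  then show ?thesis by (simp add: enat cum_weight_def mult.commute)
\<comment> \<open>At \<open>t = \<infinity>\<close> the right side is
  \<open>norm_inf w * \<infinity>\<close>, which is infinite because \<open>norm_inf w\<close> is
  positive.\<close>
qed (use assms in \<open>auto simp: ennreal_mult_top\<close>)

section \<open>Restarted mixtures of independent uniform p-values\<close>

text \<open>All that is kept of the conformal construction is the measurability and the product
  formula of the p-values; data and randomizers no longer occur.\<close>

locale restarted_mixture = prob_space M
  for M :: "'a measure" and p :: "nat \<Rightarrow> 'a \<Rightarrow> real"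
    and Q :: "'th measure" and f :: "'th \<Rightarrow> real \<Rightarrow> real" and w :: "nat \<Rightarrow> real" +
  assumes p_measurable: "\<And>i. 1 \<le> i \<Longrightarrow> p i \<in> borel_measurable M"
    and p_product: "\<And>n \<phi>. (\<And>i. \<phi> i \<in> borel_measurable borel) \<Longrightarrow>
      (\<integral>\<^sup>+\<omega>. (\<Prod>i=1..n. \<phi> i (p i \<omega>)) \<partial>M) = (\<Prod>i=1..n. \<integral>\<^sup>+u. \<phi> i u \<partial>unif)"
    and betting: "betting_class Q f"
begin

abbreviation G :: "enat \<Rightarrow> 'a measure" where "G \<equiv> p_filtration M p"
abbreviation R :: "nat \<Rightarrow> nat \<Rightarrow> 'a \<Rightarrow> ennreal" where "R \<equiv> restarted Q f p"
abbreviation S :: "nat \<Rightarrow> 'a \<Rightarrow> ennreal" where "S \<equiv> S_stat Q f p w"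
abbreviation Z :: "nat \<Rightarrow> 'a \<Rightarrow> ennreal" where "Z \<equiv> Z_stat Q f p w"

sublocale Q: prob_space Q
  using betting by (simp add: betting_class_def)

sublocale MQ: pair_sigma_finite M Q ..

section \<open>Law of the p-values and independence from the past\<close>

lemma subalgebra_G: "subalgebra M (G t)"
  unfolding subalgebra_def sets_p_filtration
  by (auto intro!: sets.sigma_sets_subset measurable_sets[OF p_measurable])

lemma G_mono: "s \<le> t \<Longrightarrow> sets (G s) \<subseteq> sets (G t)"
  using filtration.sets_F_mono[OF filtration_p_filtration] .

lemma measurable_G_mono: "s \<le> t \<Longrightarrow> D \<in> borel_measurable (G s) \<Longrightarrow> D \<in> borel_measurable (G t)"
  by (rule subsetD[OF measurable_mono]) (auto simp: G_mono)

lemma measurable_p_vector: "(\<lambda>\<omega>. \<lambda>i\<in>{1..n}. p i \<omega>) \<in> measurable M (PiM {1..n} (\<lambda>_. borel))"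
  by (intro measurable_restrict p_measurable) auto

text \<open>The product formula for indicators gives the mass of every rectangle, and rectangles
  determine the product measure.\<close>

lemma distr_p:
  "distr M (PiM {1..n} (\<lambda>_. borel)) (\<lambda>\<omega>. \<lambda>i\<in>{1..n}. p i \<omega>) = PiM {1..n} (\<lambda>_. unif)" (is "?D = _")
proof -
  interpret U: product_prob_space "\<lambda>_::nat. unif"
    by (intro product_prob_spaceI prob_space_unif)
  show ?thesis
  proof (rule U.PiM_eqI)
    show "sets ?D = sets (PiM {1..n} (\<lambda>_. unif))" by (auto intro!: sets_PiM_cong)
    fix A :: "nat \<Rightarrow> real set"
    assume A: "\<And>i. i \<in> {1..n} \<Longrightarrow> A i \<in> sets unif"
    \<comment> \<open>\<open>A\<close> is known to be measurable on \<open>{1..n}\<close> only,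
      while \<open>p_product\<close> takes a measurable function at every index; the empty set fills
      in the others.\<close>
    define B where "B i = (if i \<in> {1..n} then A i else {})" for i
    have B: "B i \<in> sets borel" for i using A by (auto simp: B_def)
    have PB: "Pi\<^sub>E {1..n} A \<in> sets (PiM {1..n} (\<lambda>_. borel))"
      using A by (intro sets_PiM_I_finite) auto
    have "emeasure ?D (Pi\<^sub>E {1..n} A) =
        (\<integral>\<^sup>+\<omega>. indicator (Pi\<^sub>E {1..n} A) (\<lambda>i\<in>{1..n}. p i \<omega>) \<partial>M)"
      using PB nn_integral_distr[OF measurable_p_vector, of "indicator (Pi\<^sub>E {1..n} A)" n]
      by simp
    also have "\<dots> = (\<integral>\<^sup>+\<omega>. (\<Prod>i=1..n. indicator (B i) (p i \<omega>)) \<partial>M)"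
    proof (intro nn_integral_cong)
      fix \<omega>
      show "indicator (Pi\<^sub>E {1..n} A) (\<lambda>i\<in>{1..n}. p i \<omega>) =
          (\<Prod>i=1..n. indicator (B i) (p i \<omega>) :: ennreal)"
      proof (cases "\<forall>i\<in>{1..n}. p i \<omega> \<in> A i")
        case True
        then show ?thesis by (auto simp: B_def PiE_iff)
      next
        case False
        then obtain i where i: "i \<in> {1..n}" "p i \<omega> \<notin> A i" by auto
        then have "(\<Prod>i=1..n. indicator (B i) (p i \<omega>) :: ennreal) = 0"
          by (intro prod_zero bexI[of _ i]) (auto simp: B_def)
        then show ?thesis using False by (auto simp: PiE_iff)
      qed
    qed
    also have "\<dots> = (\<Prod>i=1..n. emeasure unif (B i))"
      using B by (subst p_product) auto
    finally show "emeasure ?D (Pi\<^sub>E {1..n} A) = (\<Prod>i\<in>{1..n}. emeasure unif (A i))"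
      by (simp add: B_def)
  qed auto
qed

text \<open>The preimages under the vector of the first \<open>t\<close> p-values form a
  sigma-algebra containing the generators of \<open>G (enat t)\<close>. Past events thereby become
  sets in coordinate space, where the product law applies.\<close>

lemma sets_G_vimageE:
  assumes "A \<in> sets (G (enat t))"
  obtains B where "B \<in> sets (PiM {1..t} (\<lambda>_. borel))"
    "A = (\<lambda>\<omega>. \<lambda>i\<in>{1..t}. p i \<omega>) -` B \<inter> space M"
proof -
  let ?P = "PiM {1..t} (\<lambda>_. borel :: real measure)" and ?p = "\<lambda>\<omega>. \<lambda>i\<in>{1..t}. p i \<omega>"
  let ?V = "vimage_algebra (space M) ?p ?P"
  have V: "sets ?V = {?p -` B \<inter> space M | B. B \<in> sets ?P}"
    by (intro sets_vimage_algebra2) (auto simp: space_PiM)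
  have "p i -` B \<inter> space M \<in> sets ?V" if "1 \<le> i" "i \<le> t" "B \<in> sets borel" for i B
  proof -
    have "(\<lambda>x. x i) -` B \<inter> space ?P \<in> sets ?P"
      using that by (intro measurable_sets[OF measurable_component_singleton]) auto
    moreover have "p i -` B \<inter> space M = ?p -` ((\<lambda>x. x i) -` B \<inter> space ?P) \<inter> space M"
      using that by (auto simp: space_PiM)
    ultimately show ?thesis unfolding V by blast
  qed
  then have "{p i -` B \<inter> space M | i B. 1 \<le> i \<and> enat i \<le> enat t \<and> B \<in> sets borel} \<subseteq> sets ?V"
    by auto
  from sets.sigma_sets_subset[OF this] have "sets (G (enat t)) \<subseteq> sets ?V"
    unfolding sets_p_filtration by simp
  with assms V that show thesis by auto
qed

text \<open>For the indicator of a past event, the product law of the first \<open>Suc t\<close>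
  p-values and Fubini factor the integral. Nonnegative integrals throughout leave \<open>Y\<close>
  and \<open>h\<close> free to have infinite mean.\<close>

lemma nn_integral_past_times_next:
  assumes Y: "Y \<in> borel_measurable (G (enat t))" and h[measurable]: "h \<in> borel_measurable borel"
  shows "(\<integral>\<^sup>+\<omega>. Y \<omega> * h (p (Suc t) \<omega>) \<partial>M) = (\<integral>\<^sup>+\<omega>. Y \<omega> \<partial>M) * (\<integral>\<^sup>+u. h u \<partial>unif)"
proof -
  define c where "c = (\<integral>\<^sup>+u. h u \<partial>unif)"
  note [measurable] = p_measurable[of "Suc t", simplified]
  have h_unif: "h \<in> borel_measurable unif"
    using h by (simp cong: measurable_cong_sets)
  interpret U: product_prob_space "\<lambda>_::nat. unif"
    by (intro product_prob_spaceI prob_space_unif)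
  have sub': "subalgebra (density M (\<lambda>\<omega>. h (p (Suc t) \<omega>))) (G (enat t))"
    using subalgebra_G by (auto simp: subalgebra_def)
  have set_case: "(\<integral>\<^sup>+\<omega>. indicator A \<omega> * h (p (Suc t) \<omega>) \<partial>M) = emeasure M A * c"
    if A: "A \<in> sets (G (enat t))" for A
  proof -
    let ?I = "{1..Suc t}"
    let ?P = "PiM {1..t} (\<lambda>_. borel :: real measure)" and ?P' = "PiM ?I (\<lambda>_. borel :: real measure)"
    obtain B where B[measurable]: "B \<in> sets ?P" and AB: "A = (\<lambda>\<omega>. \<lambda>i\<in>{1..t}. p i \<omega>) -` B \<inter> space M"
      using sets_G_vimageE[OF A] .
    have [measurable]: "(\<lambda>x. restrict x {1..t}) \<in> measurable ?P' ?P"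
      by (intro measurable_restrict_subset) auto
    have [measurable]: "(\<lambda>x. x (Suc t)) \<in> borel_measurable ?P'"
      by (intro measurable_component_singleton) auto
    have F: "(\<lambda>x. indicator B (restrict x {1..t}) * h (x (Suc t))) \<in> borel_measurable ?P'"
      by measurable
    have I: "?I = insert (Suc t) {1..t}" by auto
    have "(\<integral>\<^sup>+\<omega>. indicator A \<omega> * h (p (Suc t) \<omega>) \<partial>M) =
        (\<integral>\<^sup>+\<omega>. indicator B (restrict (\<lambda>i\<in>?I. p i \<omega>) {1..t}) * h ((\<lambda>i\<in>?I. p i \<omega>) (Suc t)) \<partial>M)"
      by (intro nn_integral_cong)
        (auto simp: AB restrict_restrict Int_absorb1 indicator_def)
    also have "\<dots> = (\<integral>\<^sup>+x. indicator B (restrict x {1..t}) * h (x (Suc t)) \<partial>PiM ?I (\<lambda>_. unif))"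
      unfolding distr_p[symmetric] using F by (subst nn_integral_distr[OF measurable_p_vector]) simp_all
    also have "\<dots> = (\<integral>\<^sup>+x. \<integral>\<^sup>+u. indicator B (restrict (x(Suc t := u)) {1..t}) * h u \<partial>unif
        \<partial>PiM {1..t} (\<lambda>_. unif))"
    proof -
      have "sets (PiM ?I (\<lambda>_. unif)) = sets ?P'" by (intro sets_PiM_cong) auto
      then have "(\<lambda>x. indicator B (restrict x {1..t}) * h (x (Suc t))) \<in> borel_measurable (PiM ?I (\<lambda>_. unif))"
        using F by (simp cong: measurable_cong_sets)
      then show ?thesis unfolding I by (subst U.product_nn_integral_insert) auto
    qed
    also have "\<dots> = (\<integral>\<^sup>+x. indicator B x * c \<partial>PiM {1..t} (\<lambda>_. unif))"
    proof (intro nn_integral_cong)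
      fix x :: "nat \<Rightarrow> real" assume "x \<in> space (PiM {1..t} (\<lambda>_. unif))"
      \<comment> \<open>\<open>x\<close> is extensional on \<open>{1..t}\<close>, so changing
        coordinate \<open>Suc t\<close> and restricting gives \<open>x\<close> back.\<close>
      then have "restrict (x(Suc t := u)) {1..t} = x" for u
        by (auto simp: space_PiM PiE_iff extensional_def fun_eq_iff)
      then show "(\<integral>\<^sup>+u. indicator B (restrict (x(Suc t := u)) {1..t}) * h u \<partial>unif) = indicator B x * c"
        by (simp add: c_def nn_integral_cmult[OF h_unif])
    qed
    also have "\<dots> = (\<integral>\<^sup>+\<omega>. indicator B (\<lambda>i\<in>{1..t}. p i \<omega>) * c \<partial>M)"
      unfolding distr_p[symmetric] by (rule nn_integral_distr[OF measurable_p_vector]) measurable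
    also have "\<dots> = (\<integral>\<^sup>+\<omega>. indicator A \<omega> * c \<partial>M)"
      by (intro nn_integral_cong) (auto simp: AB indicator_def)
    also have "\<dots> = emeasure M A * c"
    proof -
      have "A \<in> sets M" using A subalgebra_G by (auto simp: subalgebra_def)
      then show ?thesis by (simp add: nn_integral_multc)
    qed
    finally show ?thesis .
  qed
  \<comment> \<open>As functions of \<open>Y\<close>, both sides are integrals against measures on \<open>G t\<close>, so that
    comparing these on sets suffices.\<close>
  have "restr_to_subalg (density M (\<lambda>\<omega>. h (p (Suc t) \<omega>))) (G (enat t))
      = density (restr_to_subalg M (G (enat t))) (\<lambda>_. c)"
  proof (rule measure_eqI)
    show "sets (restr_to_subalg (density M (\<lambda>\<omega>. h (p (Suc t) \<omega>))) (G (enat t)))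
      = sets (density (restr_to_subalg M (G (enat t))) (\<lambda>_. c))"
      by (simp add: sets_restr_to_subalg[OF subalgebra_G] sets_restr_to_subalg[OF sub'])
    fix A assume "A \<in> sets (restr_to_subalg (density M (\<lambda>\<omega>. h (p (Suc t) \<omega>))) (G (enat t)))"
    then have A: "A \<in> sets (G (enat t))" by (simp add: sets_restr_to_subalg[OF sub'])
    then have "A \<in> sets M" using subalgebra_G by (auto simp: subalgebra_def)
    then show "emeasure (restr_to_subalg (density M (\<lambda>\<omega>. h (p (Suc t) \<omega>))) (G (enat t))) A
      = emeasure (density (restr_to_subalg M (G (enat t))) (\<lambda>_. c)) A"
      using A set_case[OF A]
      by (simp add: emeasure_restr_to_subalg[OF sub'] emeasure_restr_to_subalg[OF subalgebra_G]
          sets_restr_to_subalg[OF subalgebra_G] emeasure_density nn_integral_cmult_indicator mult.commute)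
  qed
  note eq = this
  have YM: "Y \<in> borel_measurable M" by (rule measurable_from_subalg[OF subalgebra_G Y])
  have "(\<integral>\<^sup>+\<omega>. Y \<omega> * h (p (Suc t) \<omega>) \<partial>M) = (\<integral>\<^sup>+\<omega>. Y \<omega> \<partial>density M (\<lambda>\<omega>. h (p (Suc t) \<omega>)))"
    using YM by (subst nn_integral_density) (auto simp: mult.commute)
  also have "\<dots> = (\<integral>\<^sup>+\<omega>. Y \<omega> \<partial>restr_to_subalg (density M (\<lambda>\<omega>. h (p (Suc t) \<omega>))) (G (enat t)))"
    using Y by (intro nn_integral_subalgebra2[symmetric] sub')
  also have "\<dots> = (\<integral>\<^sup>+\<omega>. c * Y \<omega> \<partial>restr_to_subalg M (G (enat t)))"
    unfolding eq using measurable_in_subalg[OF subalgebra_G Y] by (subst nn_integral_density) auto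
  also have "\<dots> = (\<integral>\<^sup>+\<omega>. c * Y \<omega> \<partial>M)"
    using Y by (intro nn_integral_subalgebra2 subalgebra_G) auto
  also have "\<dots> = (\<integral>\<^sup>+\<omega>. Y \<omega> \<partial>M) * c"
    using YM by (subst nn_integral_cmult) (auto simp: mult.commute)
  finally show ?thesis by (simp add: c_def)
qed

section \<open>Densities and restarted mixtures\<close>

lemma f_measurable: "(\<lambda>(\<theta>, u). f \<theta> u) \<in> borel_measurable (Q \<Otimes>\<^sub>M borel)"
  using betting by (simp add: betting_class_def)

lemma f_density:
  assumes "\<theta> \<in> space Q"
  shows "(\<lambda>u. ennreal (f \<theta> u)) \<in> borel_measurable borel" "(\<integral>\<^sup>+u. ennreal (f \<theta> u) \<partial>unif) = 1"
proof -
  show m: "(\<lambda>u. ennreal (f \<theta> u)) \<in> borel_measurable borel"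
    using measurable_Pair2[OF f_measurable assms] by simp
  have "(\<integral>\<^sup>+u. ennreal (f \<theta> u) \<partial>unif) = (\<integral>\<^sup>+u. ennreal (f \<theta> u) * indicator {0..<1} u \<partial>lborel)"
    by (rule nn_integral_unif[OF m])
  also have "\<dots> = (\<integral>\<^sup>+u\<in>{0..1}. ennreal (f \<theta> u) \<partial>lborel)"
    \<comment> \<open>The closed and the half-open unit interval differ by the null set
      \<open>{1}\<close>.\<close>
    by (intro nn_integral_cong_AE, rule AE_mp[OF AE_lborel_singleton[of 1]]) (auto split: split_indicator)
  also have "\<dots> = 1" using betting assms by (simp add: betting_class_def)
  finally show "(\<integral>\<^sup>+u. ennreal (f \<theta> u) \<partial>unif) = 1" .
qed

text \<open>\<open>N\<close> is left general since joint measurability is needed over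
  \<open>M\<close>, for Fubini, and over the past, for adaptedness.\<close>

lemma measurable_bets:
  assumes "1 \<le> k" "\<And>j. 1 \<le> j \<Longrightarrow> j \<le> t \<Longrightarrow> p j \<in> borel_measurable N"
  shows "(\<lambda>(\<omega>, \<theta>). \<Prod>j=k..t. ennreal (f \<theta> (p j \<omega>))) \<in> borel_measurable (N \<Otimes>\<^sub>M Q)"
proof -
  have "(\<lambda>z. f (snd z) (p j (fst z))) \<in> borel_measurable (N \<Otimes>\<^sub>M Q)" if "j \<in> {k..t}" for j
  proof -
    have [measurable]: "p j \<in> borel_measurable N" using that assms by auto
    have "(\<lambda>z. (snd z, p j (fst z))) \<in> measurable (N \<Otimes>\<^sub>M Q) (Q \<Otimes>\<^sub>M borel)" by measurable
    from measurable_compose[OF this f_measurable] show ?thesis by simp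
  qed
  then show ?thesis
    unfolding case_prod_beta by (intro borel_measurable_prod_ennreal) auto
qed

lemma measurable_restarted:
  assumes "1 \<le> k" "t \<le> s"
  shows "R k t \<in> borel_measurable (G (enat s))"
  unfolding restarted_def using assms
  by (intro Q.borel_measurable_nn_integral measurable_bets measurable_p_filtration) auto

text \<open>Fubini fixes \<open>\<theta>\<close>; the newest factor is then independent of
  \<open>Y\<close> and of the earlier factors, and has mean one. The case \<open>k = Suc t\<close>
  compares a single factor with the empty product.\<close>

lemma nn_integral_restarted_Suc:
  assumes Y: "Y \<in> borel_measurable (G (enat t))" and k: "1 \<le> k" "k \<le> Suc t"
  shows "(\<integral>\<^sup>+\<omega>. Y \<omega> * R k (Suc t) \<omega> \<partial>M) = (\<integral>\<^sup>+\<omega>. Y \<omega> * R k t \<omega> \<partial>M)"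
proof -
  have YM[measurable]: "Y \<in> borel_measurable M" by (rule measurable_from_subalg[OF subalgebra_G Y])
  have bets[measurable]: "(\<lambda>(\<omega>, \<theta>). \<Prod>j=k..n. ennreal (f \<theta> (p j \<omega>))) \<in> borel_measurable (M \<Otimes>\<^sub>M Q)" for n
    by (intro measurable_bets p_measurable k)
  have swap: "(\<integral>\<^sup>+\<omega>. Y \<omega> * R k n \<omega> \<partial>M) = (\<integral>\<^sup>+\<theta>. \<integral>\<^sup>+\<omega>. Y \<omega> * (\<Prod>j=k..n. ennreal (f \<theta> (p j \<omega>))) \<partial>M \<partial>Q)" for n
  proof -
    have "(\<integral>\<^sup>+\<omega>. Y \<omega> * R k n \<omega> \<partial>M) = (\<integral>\<^sup>+\<omega>. \<integral>\<^sup>+\<theta>. Y \<omega> * (\<Prod>j=k..n. ennreal (f \<theta> (p j \<omega>))) \<partial>Q \<partial>M)"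
      unfolding restarted_def using measurable_Pair2[OF bets]
      by (intro nn_integral_cong nn_integral_cmult[symmetric]) simp
    also have "\<dots> = (\<integral>\<^sup>+\<theta>. \<integral>\<^sup>+\<omega>. Y \<omega> * (\<Prod>j=k..n. ennreal (f \<theta> (p j \<omega>))) \<partial>M \<partial>Q)"
    proof (rule MQ.Fubini'[symmetric])
      have "(\<lambda>z. Y (fst z) * (case z of (\<omega>, \<theta>) \<Rightarrow> \<Prod>j=k..n. ennreal (f \<theta> (p j \<omega>)))) \<in> borel_measurable (M \<Otimes>\<^sub>M Q)"
        by measurable
      then show "(\<lambda>(\<omega>, \<theta>). Y \<omega> * (\<Prod>j=k..n. ennreal (f \<theta> (p j \<omega>)))) \<in> borel_measurable (M \<Otimes>\<^sub>M Q)"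
        by (simp add: case_prod_beta)
    qed
    finally show ?thesis .
  qed
  show ?thesis unfolding swap
  proof (rule nn_integral_cong)
    fix \<theta> assume \<theta>: "\<theta> \<in> space Q"
    have "p j \<in> borel_measurable (G (enat t))" if "j \<in> {k..t}" for j
      using that k by (intro measurable_p_filtration) auto
    then have "(\<lambda>\<omega>. Y \<omega> * (\<Prod>j=k..t. ennreal (f \<theta> (p j \<omega>)))) \<in> borel_measurable (G (enat t))"
      by (intro borel_measurable_times_ennreal Y borel_measurable_prod_ennreal
          measurable_compose[OF _ f_density(1)[OF \<theta>]])
    from nn_integral_past_times_next[OF this f_density(1)[OF \<theta>]]
    show "(\<integral>\<^sup>+\<omega>. Y \<omega> * (\<Prod>j=k..Suc t. ennreal (f \<theta> (p j \<omega>))) \<partial>M)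
        = (\<integral>\<^sup>+\<omega>. Y \<omega> * (\<Prod>j=k..t. ennreal (f \<theta> (p j \<omega>))) \<partial>M)"
      using k f_density(2)[OF \<theta>] by (simp add: prod.nat_ivl_Suc' mult_ac)
  qed
qed

lemma measurable_S: "S t \<in> borel_measurable (G (enat t))"
  unfolding S_stat_def
  by (intro borel_measurable_sum borel_measurable_times_ennreal measurable_restarted) auto

lemma measurable_Z: "Z t \<in> borel_measurable (G (enat t))"
proof (cases "t = 0")
  case False
  \<comment> \<open>The maximum over the nonempty set \<open>{1..t}\<close> is rewritten as a
    supremum, which preserves measurability.\<close>
  have "Z t = (\<lambda>\<omega>. SUP k\<in>{1..t}. ennreal (w k) * R k t \<omega>)"
    using False by (auto simp: Z_stat_def fun_eq_iff intro!: Max_Sup)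
  then show ?thesis
    by (auto intro!: borel_measurable_SUP borel_measurable_times_ennreal measurable_restarted)
qed (simp add: Z_stat_def[abs_def])

lemma Z_le_S: "Z t \<omega> \<le> S t \<omega>"
proof (cases "t = 0")
  case False
  have "ennreal (w k) * R k t \<omega> \<le> S t \<omega>" if "k \<in> {1..t}" for k
    unfolding S_stat_def using that by (intro member_le_sum) auto
  then show ?thesis using False by (auto simp: Z_stat_def)
qed (simp add: Z_stat_def)

text \<open>Restarts at \<open>k \<le> t\<close> keep their expectation against \<open>Y\<close>,
  and the restart at \<open>Suc t\<close> begins with the empty product, so its weight is the only
  increment. Written as a sum, the identity also makes sense for infinite values.\<close>

lemma nn_integral_S_Suc:
  assumes Y: "Y \<in> borel_measurable (G (enat t))"
  shows "(\<integral>\<^sup>+\<omega>. Y \<omega> * S (Suc t) \<omega> \<partial>M) =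
    (\<integral>\<^sup>+\<omega>. Y \<omega> * S t \<omega> \<partial>M) + (\<integral>\<^sup>+\<omega>. Y \<omega> * ennreal (w (Suc t)) \<partial>M)"
proof -
  have YM[measurable]: "Y \<in> borel_measurable M" by (rule measurable_from_subalg[OF subalgebra_G Y])
  have R_M: "R k n \<in> borel_measurable M" if "1 \<le> k" for k n
    using that measurable_from_subalg[OF subalgebra_G measurable_restarted] by blast
  have expand: "(\<integral>\<^sup>+\<omega>. Y \<omega> * (\<Sum>k=1..m. ennreal (w k) * R k n \<omega>) \<partial>M) =
      (\<Sum>k=1..m. ennreal (w k) * (\<integral>\<^sup>+\<omega>. Y \<omega> * R k n \<omega> \<partial>M))" for m n
  proof -
    have "(\<integral>\<^sup>+\<omega>. Y \<omega> * (\<Sum>k=1..m. ennreal (w k) * R k n \<omega>) \<partial>M) =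
        (\<integral>\<^sup>+\<omega>. (\<Sum>k=1..m. ennreal (w k) * (Y \<omega> * R k n \<omega>)) \<partial>M)"
      by (simp add: sum_distrib_left mult_ac)
    also have "\<dots> = (\<Sum>k=1..m. \<integral>\<^sup>+\<omega>. ennreal (w k) * (Y \<omega> * R k n \<omega>) \<partial>M)"
      using R_M by (intro nn_integral_sum) auto
    also have "\<dots> = (\<Sum>k=1..m. ennreal (w k) * (\<integral>\<^sup>+\<omega>. Y \<omega> * R k n \<omega> \<partial>M))"
      using R_M by (intro sum.cong refl nn_integral_cmult) auto
    finally show ?thesis .
  qed
  have "(\<integral>\<^sup>+\<omega>. Y \<omega> * S (Suc t) \<omega> \<partial>M) =
      (\<Sum>k=1..Suc t. ennreal (w k) * (\<integral>\<^sup>+\<omega>. Y \<omega> * R k t \<omega> \<partial>M))"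
    unfolding S_stat_def expand using Y by (intro sum.cong refl) (simp add: nn_integral_restarted_Suc)
  also have "\<dots> = (\<integral>\<^sup>+\<omega>. Y \<omega> * S t \<omega> \<partial>M) + ennreal (w (Suc t)) * (\<integral>\<^sup>+\<omega>. Y \<omega> * R (Suc t) t \<omega> \<partial>M)"
    unfolding S_stat_def expand by simp
  also have "R (Suc t) t = (\<lambda>_. 1)" by (simp add: restarted_def Q.emeasure_space_1 fun_eq_iff)
  finally show ?thesis by (simp add: nn_integral_multc mult.commute)
qed

text \<open>Against every test function of the past, \<open>S\<close> gains \<open>w (Suc t)\<close>
  in one step, exactly what the tail loses. Indicators of past events as test functions then
  characterize the conditional expectation.\<close>

lemma martingale_S_plus_tail:
  assumes "norm_1 w < \<infinity>"
  shows "nonneg_martingale M G (\<lambda>t \<omega>. S t \<omega> + weight_tail w t)"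
proof -
  let ?D = "\<lambda>t \<omega>. S t \<omega> + weight_tail w t"
  have S_M[measurable]: "S t \<in> borel_measurable M" for t
    by (rule measurable_from_subalg[OF subalgebra_G measurable_S])
  have D_G: "?D t \<in> borel_measurable (G (enat t))" for t
    by (intro borel_measurable_add measurable_S) auto
  have const: "(\<integral>\<^sup>+\<omega>. Y \<omega> * ?D t \<omega> \<partial>M) = (\<integral>\<^sup>+\<omega>. Y \<omega> * ?D s \<omega> \<partial>M)"
    if Y: "Y \<in> borel_measurable (G (enat s))" and "s \<le> t" for Y s t
    using \<open>s \<le> t\<close>
  proof (induction t rule: dec_induct)
    case (step t)
    have [measurable]: "Y \<in> borel_measurable M" by (rule measurable_from_subalg[OF subalgebra_G Y])
    have "Y \<in> borel_measurable (G (enat t))"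
      using step(1) by (intro measurable_G_mono[OF _ Y]) auto
    then have "(\<integral>\<^sup>+\<omega>. Y \<omega> * ?D (Suc t) \<omega> \<partial>M) = (\<integral>\<^sup>+\<omega>. Y \<omega> * ?D t \<omega> \<partial>M)"
      by (simp add: weight_tail_Suc[of w t] distrib_left nn_integral_add nn_integral_S_Suc add.assoc)
    then show ?case using step by simp
  qed simp
  \<comment> \<open>The test function 1 from time 0 on shows that every expectation equals
    \<open>norm_1 w\<close>.\<close>
  have fin: "(\<integral>\<^sup>+\<omega>. ?D t \<omega> \<partial>M) < \<infinity>" for t
    using const[of "\<lambda>_. 1" 0 t] assms
    by (simp add: S_stat_def weight_tail_0 emeasure_space_1)
  have "AE \<omega> in M. nn_cond_exp M (G (enat s)) (?D t) \<omega> = ?D s \<omega>" if "s \<le> t" for s t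
  proof -
    interpret sub: finite_measure_subalgebra M "G (enat s)"
      by unfold_locales (rule subalgebra_G)
    have "AE \<omega> in M. ?D s \<omega> = nn_cond_exp M (G (enat s)) (?D t) \<omega>"
    proof (rule sub.nn_cond_exp_charact)
      fix A assume A: "A \<in> sets (G (enat s))"
      then show "(\<integral>\<^sup>+\<omega>\<in>A. ?D t \<omega> \<partial>M) = (\<integral>\<^sup>+\<omega>\<in>A. ?D s \<omega> \<partial>M)"
        using const[of "indicator A", OF _ that] by (simp add: mult.commute)
    qed (use D_G in auto)
    then show ?thesis by eventually_elim simp
  qed
  then show ?thesis
    unfolding nonneg_martingale_def
    using filtration_p_filtration subalgebra_G D_G fin by auto
qed

section \<open>Expectations at stopping times\<close>

lemma pred_stopping_time:
  assumes "stopping_time G T"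
  shows "{\<omega>\<in>space M. enat m < T \<omega>} \<in> sets (G (enat m))"
    "{\<omega>\<in>space M. T \<omega> \<le> enat m} \<in> sets (G (enat m))"
  using stopping_timeD[OF assms, of "enat m"] stopping_timeD2[OF assms, of "enat m"]
  by (auto simp: pred_def)

lemma measurable_stopping_time_borel:
  assumes "stopping_time G T"
  shows "T \<in> borel_measurable M"
  using subalgebra_G measurable_stopping_time[OF assms, of M] by (auto simp: subalgebra_def)

text \<open>There are only countably many values, so \<open>T\<close> is measurable for the discrete
  sigma-algebra, and every function of \<open>T\<close> is measurable.\<close>

lemma measurable_stopping_time_count_space:
  assumes "stopping_time G T"
  shows "T \<in> measurable M (count_space UNIV)"
  using measurable_stopping_time_borel[OF assms]
  by (auto simp: measurable_count_space_eq_countable intro: measurable_sets)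

lemma measurable_stopped_min:
  assumes T: "stopping_time G T" and D: "\<And>t. D t \<in> borel_measurable (G (enat t))"
  shows "stopped D (\<lambda>\<omega>. min (T \<omega>) (enat m)) \<in> borel_measurable (G (enat m))"
proof (induction m)
  case 0
  have "stopped D (\<lambda>\<omega>. min (T \<omega>) (enat 0)) = D 0"
    by (simp only: stopped_def min_enat_0 fun_eq_iff) simp
  then show ?case using D by simp
next
  case (Suc m)
  let ?N = "G (enat (Suc m))"
  have [measurable]: "D (Suc m) \<in> borel_measurable ?N" by (rule D)
  have [measurable]: "stopped D (\<lambda>\<omega>. min (T \<omega>) (enat m)) \<in> borel_measurable ?N"
    by (rule measurable_G_mono[OF _ Suc]) simp
  have "{\<omega>\<in>space M. T \<omega> \<le> enat m} \<in> sets ?N" "{\<omega>\<in>space M. enat m < T \<omega>} \<in> sets ?N"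
    using pred_stopping_time[OF T] G_mono[of "enat m" "enat (Suc m)"] by auto
  then have [measurable]: "(indicator {\<omega>. T \<omega> \<le> enat m} :: 'a \<Rightarrow> ennreal) \<in> borel_measurable ?N"
    "(indicator {\<omega>. enat m < T \<omega>} :: 'a \<Rightarrow> ennreal) \<in> borel_measurable ?N"
    by (auto simp: borel_measurable_indicator_iff Int_def conj_commute)
  show ?case
    unfolding stopped_min_Suc[abs_def] by measurable
qed

lemma measurable_cum_weight_min:
  assumes T: "stopping_time G T"
  shows "(\<lambda>\<omega>. cum_weight w (min (T \<omega>) (enat m))) \<in> borel_measurable M"
proof (induction m)
  case (Suc m)
  have "{\<omega>\<in>space M. enat m < T \<omega>} \<in> sets M"
    using pred_stopping_time(1)[OF T, of m] subalgebra_G by (auto simp: subalgebra_def)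
  then show ?case
    unfolding cum_weight_min_Suc of_bool_def
    by (intro borel_measurable_add Suc borel_measurable_times_ennreal measurable_If) auto
qed (simp only: min_enat_0, simp)

text \<open>The event that \<open>T\<close> exceeds \<open>m\<close> is known at time
  \<open>m\<close>, so on it the one-step identity adds \<open>w (Suc m)\<close> in expectation, and
  \<open>cum_weight\<close> grows by the same amount.\<close>

lemma nn_integral_stopped_S_min:
  assumes T: "stopping_time G T"
  shows "(\<integral>\<^sup>+\<omega>. stopped S (\<lambda>\<omega>. min (T \<omega>) (enat m)) \<omega> \<partial>M) =
    (\<integral>\<^sup>+\<omega>. cum_weight w (min (T \<omega>) (enat m)) \<partial>M)"
proof (induction m)
  case 0
  then show ?case
    by (simp only: stopped_def min_enat_0) (simp add: cum_weight_def S_stat_def)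
next
  case (Suc m)
  let ?T = "\<lambda>m \<omega>. min (T \<omega>) (enat m)"
  let ?L = "indicator {\<omega>. T \<omega> \<le> enat m} :: 'a \<Rightarrow> ennreal"
    and ?U = "indicator {\<omega>. enat m < T \<omega>} :: 'a \<Rightarrow> ennreal"
  have LU: "?L \<in> borel_measurable (G (enat m))" "?U \<in> borel_measurable (G (enat m))"
    using pred_stopping_time[OF T]
    by (auto simp: borel_measurable_indicator_iff Int_def conj_commute)
  note [measurable] = LU[THEN measurable_from_subalg[OF subalgebra_G]]
    measurable_from_subalg[OF subalgebra_G measurable_S]
    measurable_from_subalg[OF subalgebra_G measurable_stopped_min[OF T measurable_S]]
  have "(\<integral>\<^sup>+\<omega>. stopped S (?T (Suc m)) \<omega> \<partial>M) =
      (\<integral>\<^sup>+\<omega>. ?L \<omega> * stopped S (?T m) \<omega> \<partial>M) + (\<integral>\<^sup>+\<omega>. ?U \<omega> * S (Suc m) \<omega> \<partial>M)"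
    unfolding stopped_min_Suc by (rule nn_integral_add) measurable
  also have "\<dots> = ((\<integral>\<^sup>+\<omega>. ?L \<omega> * stopped S (?T m) \<omega> \<partial>M) + (\<integral>\<^sup>+\<omega>. ?U \<omega> * S m \<omega> \<partial>M)) +
      (\<integral>\<^sup>+\<omega>. ?U \<omega> * ennreal (w (Suc m)) \<partial>M)"
    using LU by (simp add: nn_integral_S_Suc add.assoc)
  \<comment> \<open>By \<open>stopped_min_split\<close> the two pieces recombine to the value at
    truncation \<open>m\<close>, to which the induction hypothesis applies.\<close>
  also have "(\<integral>\<^sup>+\<omega>. ?L \<omega> * stopped S (?T m) \<omega> \<partial>M) + (\<integral>\<^sup>+\<omega>. ?U \<omega> * S m \<omega> \<partial>M) =
      (\<integral>\<^sup>+\<omega>. stopped S (?T m) \<omega> \<partial>M)"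
    by (subst nn_integral_add[symmetric]) (measurable, simp flip: stopped_min_split)
  also have "\<dots> + (\<integral>\<^sup>+\<omega>. ?U \<omega> * ennreal (w (Suc m)) \<partial>M) =
      (\<integral>\<^sup>+\<omega>. cum_weight w (?T m \<omega>) + ?U \<omega> * ennreal (w (Suc m)) \<partial>M)"
    unfolding Suc using measurable_cum_weight_min[OF T] by (subst nn_integral_add) auto
  also have "\<dots> = (\<integral>\<^sup>+\<omega>. cum_weight w (?T (Suc m) \<omega>) \<partial>M)"
    unfolding cum_weight_min_Suc by (intro nn_integral_cong) (auto split: split_indicator)
  finally show ?case .
qed

text \<open>Fatou's lemma: a bound uniform in the truncation level passes to the limit inferior,
  which is the stopped value also where \<open>T\<close> is infinite.\<close>

lemma nn_integral_stopped_le: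
  assumes T: "stopping_time G T" and D: "\<And>t. D t \<in> borel_measurable (G (enat t))"
    and le: "\<And>m. (\<integral>\<^sup>+\<omega>. stopped D (\<lambda>\<omega>. min (T \<omega>) (enat m)) \<omega> \<partial>M) \<le> K"
  shows "(\<integral>\<^sup>+\<omega>. stopped D T \<omega> \<partial>M) \<le> K"
proof -
  have "(\<integral>\<^sup>+\<omega>. stopped D T \<omega> \<partial>M) =
      (\<integral>\<^sup>+\<omega>. liminf (\<lambda>m. stopped D (\<lambda>\<omega>. min (T \<omega>) (enat m)) \<omega>) \<partial>M)"
    by (intro nn_integral_cong stopped_eq_liminf_stopped_min)
  also have "\<dots> \<le> liminf (\<lambda>m. \<integral>\<^sup>+\<omega>. stopped D (\<lambda>\<omega>. min (T \<omega>) (enat m)) \<omega> \<partial>M)"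
    by (intro nn_integral_liminf measurable_from_subalg[OF subalgebra_G measurable_stopped_min] T D)
  also have "\<dots> \<le> liminf (\<lambda>m::nat. K)"
    using le by (intro Liminf_mono always_eventually) auto
  finally show ?thesis by (simp add: Liminf_const)
qed

lemma nn_integral_cum_weight_le:
  assumes "0 < norm_inf w" "stopping_time G T"
  shows "(\<integral>\<^sup>+\<omega>. cum_weight w (T \<omega>) \<partial>M) \<le> norm_inf w * (\<integral>\<^sup>+\<omega>. ennreal_of_enat (T \<omega>) \<partial>M)"
proof -
  note [measurable] = measurable_stopping_time_count_space[OF assms(2)]
  have "(\<integral>\<^sup>+\<omega>. norm_inf w * ennreal_of_enat (T \<omega>) \<partial>M) = norm_inf w * (\<integral>\<^sup>+\<omega>. ennreal_of_enat (T \<omega>) \<partial>M)"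
    by (intro nn_integral_cmult) measurable
  then show ?thesis
    using nn_integral_mono[of M "\<lambda>\<omega>. cum_weight w (T \<omega>)", OF cum_weight_le_norm_inf[OF assms(1)]] by simp
qed

section \<open>Bounds for adapted processes below \<open>S\<close>, covering \<open>S\<close> and
  \<open>Z\<close> at once\<close>

context
  fixes D :: "nat \<Rightarrow> 'a \<Rightarrow> ennreal"
  assumes D_G: "\<And>t. D t \<in> borel_measurable (G (enat t))"
    and D_le_S: "\<And>t \<omega>. D t \<omega> \<le> S t \<omega>"
begin

lemma nn_integral_stopped_min_le_cum_weight:
  assumes "stopping_time G T"
  shows "(\<integral>\<^sup>+\<omega>. stopped D (\<lambda>\<omega>. min (T \<omega>) (enat m)) \<omega> \<partial>M) \<le> (\<integral>\<^sup>+\<omega>. cum_weight w (min (T \<omega>) (enat m)) \<partial>M)"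
  unfolding nn_integral_stopped_S_min[OF assms, symmetric]
  by (intro nn_integral_mono stopped_mono D_le_S)

lemma nn_integral_stopped_le_cum_weight:
  assumes "stopping_time G T"
  shows "(\<integral>\<^sup>+\<omega>. stopped D T \<omega> \<partial>M) \<le> (\<integral>\<^sup>+\<omega>. cum_weight w (T \<omega>) \<partial>M)"
  by (rule nn_integral_stopped_le[OF assms D_G order_trans[OF nn_integral_stopped_min_le_cum_weight[OF assms]]])
    (intro nn_integral_mono cum_weight_mono, simp)

lemma stopping_time_alarm_D: "stopping_time G (alarm D b)"
  by (rule stopping_time_alarm[OF filtration_p_filtration D_G])

text \<open>Markov's inequality at the minimum of the alarm and \<open>\<sigma>\<close>: on the
  event this minimum is the finite alarm time, where \<open>D\<close> is at least
  \<open>b\<close>.\<close>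

lemma alarm_probability_le:
  assumes "0 < b" "stopping_time G \<sigma>"
  shows "emeasure M {\<omega>\<in>space M. alarm D b \<omega> < \<infinity> \<and> alarm D b \<omega> \<le> \<sigma> \<omega>} \<le>
    (\<integral>\<^sup>+\<omega>. cum_weight w (min (alarm D b \<omega>) (\<sigma> \<omega>)) \<partial>M) / ennreal b"
proof -
  let ?T = "\<lambda>\<omega>. min (alarm D b \<omega>) (\<sigma> \<omega>)"
  let ?E = "{\<omega>\<in>space M. alarm D b \<omega> < \<infinity> \<and> alarm D b \<omega> \<le> \<sigma> \<omega>}"
  have T: "stopping_time G ?T"
    by (intro stopping_time_min stopping_time_alarm_D assms)
  have "alarm D b \<in> borel_measurable M" "\<sigma> \<in> borel_measurable M"
    by (rule measurable_stopping_time_borel[OF stopping_time_alarm_D]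
        measurable_stopping_time_borel[OF assms(2)])+
  then have "?E \<in> sets M" by measurable
  then have "ennreal b * emeasure M ?E = (\<integral>\<^sup>+\<omega>. ennreal b * indicator ?E \<omega> \<partial>M)"
    by (simp add: nn_integral_cmult_indicator)
  also have "\<dots> \<le> (\<integral>\<^sup>+\<omega>. stopped D ?T \<omega> \<partial>M)"
  proof (intro nn_integral_mono)
    fix \<omega>
    show "ennreal b * indicator ?E \<omega> \<le> stopped D ?T \<omega>"
    proof (cases "\<omega> \<in> ?E")
      case True
      then obtain n where n: "alarm D b \<omega> = enat n" "?T \<omega> = enat n"
        by (cases "alarm D b \<omega>") (auto simp: min_def)
      then show ?thesis using True alarm_eq_enatD(2)[OF n(1)] by (simp add: stopped_def)
    qed simp
  qed
  also have "\<dots> \<le> (\<integral>\<^sup>+\<omega>. cum_weight w (?T \<omega>) \<partial>M)"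
    by (rule nn_integral_stopped_le_cum_weight[OF T])
  finally have "ennreal b * emeasure M ?E / ennreal b \<le> (\<integral>\<^sup>+\<omega>. cum_weight w (?T \<omega>) \<partial>M) / ennreal b"
    by (rule divide_right_mono_ennreal)
  then show ?thesis
    using \<open>0 < b\<close> by (simp add: ennreal_mult_divide_eq mult.commute[of "ennreal b"])
qed

lemma alarm_probability_le_norm_1:
  assumes "0 < b"
  shows "emeasure M {\<omega>\<in>space M. alarm D b \<omega> < \<infinity>} \<le> norm_1 w / ennreal b"
proof -
  have "emeasure M {\<omega>\<in>space M. alarm D b \<omega> < \<infinity>} \<le>
      (\<integral>\<^sup>+\<omega>. cum_weight w (min (alarm D b \<omega>) \<infinity>) \<partial>M) / ennreal b"
    \<comment> \<open>Taking \<open>\<sigma>\<close> constantly infinite leaves only the condition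
      that the alarm is finite.\<close>
    using alarm_probability_le[OF assms stopping_time_const[of G \<infinity>]] by simp
  also have "\<dots> \<le> (\<integral>\<^sup>+\<omega>. norm_1 w \<partial>M) / ennreal b"
    by (intro divide_right_mono_ennreal nn_integral_mono cum_weight_le_norm_1)
  finally show ?thesis by (simp add: emeasure_space_1)
qed

context
  assumes norm_inf: "0 < norm_inf w" "norm_inf w < \<infinity>"
begin

text \<open>The bound is proved at truncated times, where \<open>stopped\<close> is an ordinary
  value and the division can be pulled out directly; Fatou then covers infinite
  \<open>T\<close>.\<close>

lemma e_detector_div_norm_inf: "e_detector M G (\<lambda>t \<omega>. D t \<omega> / norm_inf w)"
  unfolding e_detector_def
proof (intro conjI allI impI)
  show D': "(\<lambda>\<omega>. D t \<omega> / norm_inf w) \<in> borel_measurable (G (enat t))" for t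
    using D_G[of t] by (intro borel_measurable_divide_ennreal) auto
  fix T assume T: "stopping_time G T"
  show "(\<integral>\<^sup>+\<omega>. stopped (\<lambda>t \<omega>. D t \<omega> / norm_inf w) T \<omega> \<partial>M) \<le> (\<integral>\<^sup>+\<omega>. ennreal_of_enat (T \<omega>) \<partial>M)"
  proof (rule nn_integral_stopped_le[OF T D'])
    fix m
    let ?T = "\<lambda>\<omega>. min (T \<omega>) (enat m)"
    have T': "stopping_time G ?T"
      by (intro stopping_time_min T stopping_time_const)
    have "(\<integral>\<^sup>+\<omega>. stopped (\<lambda>t \<omega>. D t \<omega> / norm_inf w) ?T \<omega> \<partial>M) = (\<integral>\<^sup>+\<omega>. stopped D ?T \<omega> / norm_inf w \<partial>M)"
    proof (intro nn_integral_cong)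
      fix \<omega>
      have "?T \<omega> \<noteq> \<infinity>" by (cases "T \<omega>") auto
      then show "stopped (\<lambda>t \<omega>. D t \<omega> / norm_inf w) ?T \<omega> = stopped D ?T \<omega> / norm_inf w"
        by (auto simp: stopped_def)
    qed
    also have "\<dots> = (\<integral>\<^sup>+\<omega>. stopped D ?T \<omega> \<partial>M) / norm_inf w"
      by (intro nn_integral_divide measurable_from_subalg[OF subalgebra_G measurable_stopped_min] T D_G)
    also have "\<dots> \<le> (\<integral>\<^sup>+\<omega>. ennreal_of_enat (?T \<omega>) \<partial>M)"
      using nn_integral_stopped_min_le_cum_weight[OF T] nn_integral_cum_weight_le[OF norm_inf(1) T'] norm_inf
      by (intro divide_le_posI_ennreal) (auto intro: order_trans)
    also have "\<dots> \<le> (\<integral>\<^sup>+\<omega>. ennreal_of_enat (T \<omega>) \<partial>M)"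
      by (intro nn_integral_mono) simp
    finally show "(\<integral>\<^sup>+\<omega>. stopped (\<lambda>t \<omega>. D t \<omega> / norm_inf w) ?T \<omega> \<partial>M) \<le> \<dots>" .
  qed
qed

text \<open>If the expected alarm time is finite, the alarm is almost surely finite and
  \<open>D\<close> is at least \<open>b\<close> there, while the mean of the stopped
  \<open>D\<close> is at most \<open>norm_inf w\<close> times the expected alarm time.\<close>

lemma expected_alarm_ge: "ennreal b / norm_inf w \<le> (\<integral>\<^sup>+\<omega>. ennreal_of_enat (alarm D b \<omega>) \<partial>M)"
proof (cases "(\<integral>\<^sup>+\<omega>. ennreal_of_enat (alarm D b \<omega>) \<partial>M) = \<infinity>")
  case False
  have T: "stopping_time G (alarm D b)" by (rule stopping_time_alarm_D)
  note [measurable] = measurable_stopping_time_count_space[OF T]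
  have "AE \<omega> in M. ennreal_of_enat (alarm D b \<omega>) \<noteq> \<infinity>"
    using False by (intro nn_integral_noteq_infinite) measurable
  then have "AE \<omega> in M. ennreal b \<le> stopped D (alarm D b) \<omega>"
  proof eventually_elim
    fix \<omega> assume "ennreal_of_enat (alarm D b \<omega>) \<noteq> \<infinity>"
    then obtain n where "alarm D b \<omega> = enat n" by (cases "alarm D b \<omega>") auto
    then show "ennreal b \<le> stopped D (alarm D b) \<omega>"
      using alarm_eq_enatD(2) by (simp add: stopped_def)
  qed
  then have "(\<integral>\<^sup>+\<omega>. ennreal b \<partial>M) \<le> (\<integral>\<^sup>+\<omega>. stopped D (alarm D b) \<omega> \<partial>M)"
    by (rule nn_integral_mono_AE)
  also have "\<dots> \<le> norm_inf w * (\<integral>\<^sup>+\<omega>. ennreal_of_enat (alarm D b \<omega>) \<partial>M)"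
    using nn_integral_stopped_le_cum_weight[OF T] nn_integral_cum_weight_le[OF norm_inf(1) T] by (rule order_trans)
  finally show ?thesis
    using norm_inf by (intro divide_le_posI_ennreal) (simp_all add: emeasure_space_1)
qed simp

text \<open>The weight at the minimum is at most the weight at \<open>\<sigma>\<close>, which is at
  most \<open>norm_inf w\<close> per unit of time.\<close>

lemma alarm_probability_le_expectation:
  assumes "0 < b" "stopping_time G \<sigma>"
  shows "emeasure M {\<omega>\<in>space M. alarm D b \<omega> < \<infinity> \<and> alarm D b \<omega> \<le> \<sigma> \<omega>} \<le>
    norm_inf w * (\<integral>\<^sup>+\<omega>. ennreal_of_enat (\<sigma> \<omega>) \<partial>M) / ennreal b"
proof -
  have "(\<integral>\<^sup>+\<omega>. cum_weight w (min (alarm D b \<omega>) (\<sigma> \<omega>)) \<partial>M) \<le> (\<integral>\<^sup>+\<omega>. cum_weight w (\<sigma> \<omega>) \<partial>M)"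
    by (intro nn_integral_mono cum_weight_mono) simp
  also have "\<dots> \<le> norm_inf w * (\<integral>\<^sup>+\<omega>. ennreal_of_enat (\<sigma> \<omega>) \<partial>M)"
    by (rule nn_integral_cum_weight_le[OF norm_inf(1) assms(2)])
  finally show ?thesis
    using alarm_probability_le[OF assms] by (blast intro: order_trans divide_right_mono_ennreal)
qed

end

end

end

section \<open>Specialization to conformal p-values\<close>

theorem theorem2p7:
  fixes M :: "'a measure"
    and X lam p :: "nat \<Rightarrow> 'a \<Rightarrow> real"
    and Q :: "'th measure"
    and f :: "'th \<Rightarrow> real \<Rightarrow> real"
    and w :: "nat \<Rightarrow> real"
    and b :: real
    and G :: "enat \<Rightarrow> 'a measure"
    and S Z :: "nat \<Rightarrow> 'a \<Rightarrow> ennreal"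
    and tauS tauZ :: "'a \<Rightarrow> enat"
  assumes "prob_space M"
    and "exchangeable M X"
    and "iid_uniform M lam"
    and "indep_sequences M X lam"
    and "betting_class Q f"
    and "\<And>k. 1 \<le> k \<Longrightarrow> 0 \<le> w k"
    and "0 < b"
  defines "p \<equiv> conformal_p X lam"
    and "G \<equiv> p_filtration M p"
    and "S \<equiv> S_stat Q f p w"
    and "Z \<equiv> Z_stat Q f p w"
    and "tauS \<equiv> alarm S b"
    and "tauZ \<equiv> alarm Z b"
  shows
    "(norm_1 w < \<infinity> \<longrightarrow>
        nonneg_martingale M G (\<lambda>t \<omega>. S t \<omega> + weight_tail w t) \<and>
        (\<forall>\<omega>\<in>space M. S 0 \<omega> + weight_tail w 0 = norm_1 w) \<and>
        emeasure M {\<omega> \<in> space M. tauS \<omega> < \<infinity>} \<le> norm_1 w / ennreal b \<and>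
        emeasure M {\<omega> \<in> space M. tauZ \<omega> < \<infinity>} \<le> norm_1 w / ennreal b)
     \<and>
     (\<forall>\<tau>. stopping_time G \<tau> \<and> (\<integral>\<^sup>+\<omega>. ennreal_of_enat (\<tau> \<omega>) \<partial>M) < \<infinity> \<longrightarrow>
        (\<integral>\<^sup>+\<omega>. stopped S \<tau> \<omega> \<partial>M) \<le> (\<integral>\<^sup>+\<omega>. cum_weight w (\<tau> \<omega>) \<partial>M) \<and>
        (\<integral>\<^sup>+\<omega>. stopped Z \<tau> \<omega> \<partial>M) \<le> (\<integral>\<^sup>+\<omega>. cum_weight w (\<tau> \<omega>) \<partial>M))
     \<and>
     (\<forall>\<sigma>. stopping_time G \<sigma> \<longrightarrow>
        emeasure M {\<omega> \<in> space M. tauS \<omega> < \<infinity> \<and> tauS \<omega> \<le> \<sigma> \<omega>}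
          \<le> (\<integral>\<^sup>+\<omega>. cum_weight w (min (tauS \<omega>) (\<sigma> \<omega>)) \<partial>M) / ennreal b \<and>
        emeasure M {\<omega> \<in> space M. tauZ \<omega> < \<infinity> \<and> tauZ \<omega> \<le> \<sigma> \<omega>}
          \<le> (\<integral>\<^sup>+\<omega>. cum_weight w (min (tauZ \<omega>) (\<sigma> \<omega>)) \<partial>M) / ennreal b)
     \<and>
     (0 < norm_inf w \<and> norm_inf w < \<infinity> \<longrightarrow>
        (\<forall>\<tau>. stopping_time G \<tau> \<longrightarrow>
           (\<integral>\<^sup>+\<omega>. cum_weight w (\<tau> \<omega>) \<partial>M)
             \<le> norm_inf w * (\<integral>\<^sup>+\<omega>. ennreal_of_enat (\<tau> \<omega>) \<partial>M)) \<and>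
        e_detector M G (\<lambda>t \<omega>. S t \<omega> / norm_inf w) \<and>
        e_detector M G (\<lambda>t \<omega>. Z t \<omega> / norm_inf w) \<and>
        ennreal b / norm_inf w \<le> (\<integral>\<^sup>+\<omega>. ennreal_of_enat (tauS \<omega>) \<partial>M) \<and>
        ennreal b / norm_inf w \<le> (\<integral>\<^sup>+\<omega>. ennreal_of_enat (tauZ \<omega>) \<partial>M) \<and>
        (\<forall>\<sigma>. stopping_time G \<sigma> \<longrightarrow>
           max (emeasure M {\<omega> \<in> space M. tauS \<omega> < \<infinity> \<and> tauS \<omega> \<le> \<sigma> \<omega>})
               (emeasure M {\<omega> \<in> space M. tauZ \<omega> < \<infinity> \<and> tauZ \<omega> \<le> \<sigma> \<omega>})
             \<le> norm_inf w * (\<integral>\<^sup>+\<omega>. ennreal_of_enat (\<sigma> \<omega>) \<partial>M) / ennreal b))"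
proof -
  interpret prob_space M by fact
  interpret restarted_mixture M p Q f w
  proof
    show "p i \<in> borel_measurable M" if "1 \<le> i" for i
      unfolding p_def using assms(2,3) that by (rule measurable_conformal_p)
    show "(\<integral>\<^sup>+\<omega>. (\<Prod>i=1..n. \<phi> i (p i \<omega>)) \<partial>M) = (\<Prod>i=1..n. \<integral>\<^sup>+u. \<phi> i u \<partial>unif)"
      if "\<And>i. \<phi> i \<in> borel_measurable borel" for n \<phi>
      unfolding p_def using assms(2-4) that by (rule nn_integral_prod_conformal_p)
  qed fact
  \<comment> \<open>Each pair discharges the two assumptions on \<open>D\<close>: once for
    \<open>D\<close> equal to \<open>S\<close>, where domination is reflexivity, and once for
    \<open>D\<close> equal to \<open>Z\<close>.\<close>
  note S = measurable_S order.refl and Z = measurable_Z Z_le_S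
  note defs = G_def S_def Z_def tauS_def tauZ_def
  note b = \<open>0 < b\<close>
  show ?thesis
    unfolding defs
  proof (intro conjI impI allI ballI; (elim conjE)?)
    show "S_stat Q f p w 0 \<omega> + weight_tail w 0 = norm_1 w" for \<omega>
      by (simp add: S_stat_def weight_tail_0)
  qed (use b in \<open>blast intro: martingale_S_plus_tail
      alarm_probability_le_norm_1[OF S] alarm_probability_le_norm_1[OF Z]
      nn_integral_stopped_le_cum_weight[OF S] nn_integral_stopped_le_cum_weight[OF Z]
      alarm_probability_le[OF S] alarm_probability_le[OF Z]
      nn_integral_cum_weight_le
      e_detector_div_norm_inf[OF S] e_detector_div_norm_inf[OF Z]
      expected_alarm_ge[OF S] expected_alarm_ge[OF Z]
      alarm_probability_le_expectation[OF S] alarm_probability_le_expectation[OF Z]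
      max.boundedI
      \<close>)+
qed

end
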